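(* Let $(A,\cdot)$ be a commutative associative $\mathbb K$-algebra and $(L,[\cdot,\dots,\cdot],\varepsilon,\alpha,\beta)$ an $n$-BiHom-Lie color algebra. Then the tensor product $A\otimes L=\bigoplus_{\gamma\in\Gamma}(A\otimes L)_\gamma$, $(A\otimes L)_\gamma=A\otimes L_\gamma$, with the bracket $[a_1\otimes x_1,\dots,a_n\otimes x_n]'=a_1\cdots a_n\otimes[x_1,\dots,x_n]$, the even linear maps $\alpha'(a\otimes x)=a\otimes\alpha(x)$ and $\beta'(a\otimes x)=a\otimes\beta(x)$, and the bicharacter $\varepsilon$ (the degree of $a\otimes x$ being the degree of $x$, for $a\in A$ and $x\in L$ homogeneous), is an $n$-BiHom-Lie color algebra.
   Context: $\mathbb K$ is a field of characteristic different from $2$, $\Gamma$ is an abelian group (written additively) with identity element $e$, and all graded spaces are $\Gamma$-graded $\mathbb K$-vector spaces. A (skew-symmetric) bicharacter is a map $\varepsilon:\Gamma\times\Gamma\to\mathbb K^*$ with $\varepsilon(a,b)\varepsilon(b,a)=1$, $\varepsilon(a,b+c)=\varepsilon(a,b)\varepsilon(a,c)$, $\varepsilon(a+b,c)=\varepsilon(a,c)\varepsilon(b,c)$. Inside $\varepsilon$ and inside sums of arguments of $\varepsilon$, a homogeneous element stands for its degree. A (multi)linear map is even if it has degree zero (it preserves degree). An $n$-BiHom-Lie color algebra is a $5$-tuple $(L,[\cdot,\dots,\cdot],\varepsilon,\alpha,\beta)$ with $L$ a $\Gamma$-graded vector space, $[\cdot,\dots,\cdot]:L\times\dots\times L\to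 L$ an even $n$-linear map, $\varepsilon$ a bicharacter and $\alpha,\beta:L\to L$ even linear maps such that, for all homogeneous elements: (1) $\alpha\circ\beta=\beta\circ\alpha$; (2) $[\beta(x_1),\dots,\beta(x_k),\beta(x_{k+1}),\dots,\beta(x_{n-1}),\alpha(x_n)]=-\varepsilon(x_k,x_{k+1})[\beta(x_1),\dots,\beta(x_{k+1}),\beta(x_k),\dots,\beta(x_{n-1}),\alpha(x_n)]$ for $k=1,\dots,n-2$, and $[\beta(x_1),\dots,\beta(x_{n-1}),\alpha(x_n)]=-\varepsilon(x_{n-1},x_n)[\beta(x_1),\dots,\beta(x_{n-2}),\beta(x_n),\alpha(x_{n-1})]$; (3) $[\beta^2(x_1),\dots,\beta^2(x_{n-1}),[\beta(y_1),\dots,\beta(y_{n-1}),\alpha(y_n)]]=\sum_{k=1}^n\varepsilon(X,Y_k)[\beta^2(y_1),\dots,\beta^2(y_{k-1}),[\beta(x_1),\dots,\beta(x_{n-1}),\alpha(y_k)],\beta^2(y_{k+1}),\dots,\beta^2(y_n)]$, where $X=\sum_{k=1}^{n-1}x_k$ and $Y_k=\sum_{l=1}^{k}y_{l-1}$ with $y_0=e$ (that is, $Y_k$ is the sum of the degrees of $y_1,\dots,y_{k-1}$). *)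

theory Defs
  imports "HOL-Algebra.AbelCoset" "HOL-Algebra.Module" "HOL.Hull" "HOL-Combinatorics.Transposition"
begin

section \<open>Linear and multilinear maps\<close>

definition linear_map ::
  "('k, 'm) ring_scheme \<Rightarrow> ('k, 'v, 'p) module_scheme \<Rightarrow> ('k, 'w, 'q) module_scheme \<Rightarrow> ('v \<Rightarrow> 'w) \<Rightarrow> bool"
  where "linear_map K V W f \<longleftrightarrow>
    f \<in> carrier V \<rightarrow> carrier W \<and>
    (\<forall>x\<in>carrier V. \<forall>y\<in>carrier V. f (x \<oplus>\<^bsub>V\<^esub> y) = f x \<oplus>\<^bsub>W\<^esub> f y) \<and>
    (\<forall>c\<in>carrier K. \<forall>x\<in>carrier V. f (c \<odot>\<^bsub>V\<^esub> x) = c \<odot>\<^bsub>W\<^esub> f x)"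

text \<open>An \<open>n\<close>-ary operation takes its arguments as a list; only its values on lists of length \<open>n\<close>
  over the carrier are relevant.\<close>

definition multilinear_map ::
  "('k, 'm) ring_scheme \<Rightarrow> ('k, 'v, 'p) module_scheme \<Rightarrow> nat \<Rightarrow> ('v list \<Rightarrow> 'v) \<Rightarrow> bool"
  where "multilinear_map K V n f \<longleftrightarrow>
    (\<forall>xs. length xs = n \<and> set xs \<subseteq> carrier V \<longrightarrow>
      f xs \<in> carrier V \<and>
      (\<forall>i<n. linear_map K V V (\<lambda>x. f (xs[i := x]))))"

section \<open>Graded vector spaces and bicharacters\<close>

text \<open>The grading group is an abelian group in the sense of HOL-Algebra, hence written
  multiplicatively: \<open>a \<otimes>\<^bsub>\<Gamma>\<^esub> b\<close> is the sum of degrees, \<open>\<one>\<^bsub>\<Gamma>\<^esub>\<close> is \<open>e\<close>. The grading \<open>Vg\<close> is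
  an internal direct sum decomposition.\<close>

locale graded_vector_space =
  V?: module K V + K?: field K + \<Gamma>?: comm_group \<Gamma>
  for K :: "('k, 'm) ring_scheme" and \<Gamma> :: "('g, 'l) monoid_scheme"
    and V :: "('k, 'v, 'p) module_scheme" +
  fixes Vg :: "'g \<Rightarrow> 'v set"
  assumes component_submodule: "\<gamma> \<in> carrier \<Gamma> \<Longrightarrow> submodule (Vg \<gamma>) K V"
    and unique_decomposition: "v \<in> carrier V \<Longrightarrow>
      \<exists>!f. f \<in> (\<Pi>\<^sub>E \<gamma>\<in>carrier \<Gamma>. Vg \<gamma>) \<and>
           finite {\<gamma> \<in> carrier \<Gamma>. f \<gamma> \<noteq> \<zero>\<^bsub>V\<^esub>} \<and>
           v = (\<Oplus>\<^bsub>V\<^esub>\<gamma>\<in>{\<gamma> \<in> carrier \<Gamma>. f \<gamma> \<noteq> \<zero>\<^bsub>V\<^esub>}. f \<gamma>)"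

locale bicharacter =
  fixes K :: "('k, 'm) ring_scheme" and \<Gamma> :: "('g, 'l) monoid_scheme"
    and \<epsilon> :: "'g \<Rightarrow> 'g \<Rightarrow> 'k"
  assumes bichar_units: "\<lbrakk>a \<in> carrier \<Gamma>; b \<in> carrier \<Gamma>\<rbrakk> \<Longrightarrow> \<epsilon> a b \<in> Units K"
    and bichar_skew: "\<lbrakk>a \<in> carrier \<Gamma>; b \<in> carrier \<Gamma>\<rbrakk> \<Longrightarrow> \<epsilon> a b \<otimes>\<^bsub>K\<^esub> \<epsilon> b a = \<one>\<^bsub>K\<^esub>"
    and bichar_right: "\<lbrakk>a \<in> carrier \<Gamma>; b \<in> carrier \<Gamma>; c \<in> carrier \<Gamma>\<rbrakk> \<Longrightarrow>
      \<epsilon> a (b \<otimes>\<^bsub>\<Gamma>\<^esub> c) = \<epsilon> a b \<otimes>\<^bsub>K\<^esub> \<epsilon> a c"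
    and bichar_left: "\<lbrakk>a \<in> carrier \<Gamma>; b \<in> carrier \<Gamma>; c \<in> carrier \<Gamma>\<rbrakk> \<Longrightarrow>
      \<epsilon> (a \<otimes>\<^bsub>\<Gamma>\<^esub> b) c = \<epsilon> a c \<otimes>\<^bsub>K\<^esub> \<epsilon> b c"

section \<open>BiHom-Lie color algebras\<close>

text \<open>\<open>bihom_args n \<alpha> \<beta> x\<close> is the argument list \<open>\<beta>(x\<^sub>1), \<dots>, \<beta>(x\<^bsub>n-1\<^esub>), \<alpha>(x\<^sub>n)\<close>.\<close>

definition bihom_args :: "nat \<Rightarrow> ('v \<Rightarrow> 'v) \<Rightarrow> ('v \<Rightarrow> 'v) \<Rightarrow> (nat \<Rightarrow> 'v) \<Rightarrow> 'v list"
  where "bihom_args n \<alpha> \<beta> x = map (\<lambda>i. \<beta> (x i)) [1..<n] @ [\<alpha> (x n)]"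

text \<open>Homogeneous elements come with chosen degrees: \<open>d i\<close> is a degree of \<open>x i\<close> and \<open>e i\<close> one
  of \<open>y i\<close>. For a zero element every degree is allowed; this is harmless, as both sides of the
  identities vanish then.

  The two skew-symmetry identities (for \<open>k \<le> n - 2\<close> and for \<open>k = n - 1\<close>) are both
  \<open>[\<beta>(x\<^sub>1), \<dots>, \<beta>(x\<^bsub>n-1\<^esub>), \<alpha>(x\<^sub>n)] = - \<epsilon>(x\<^sub>k, x\<^bsub>k+1\<^esub>) [\<beta>(z\<^sub>1), \<dots>, \<beta>(z\<^bsub>n-1\<^esub>), \<alpha>(z\<^sub>n)]\<close> where \<open>z\<close> is
  \<open>x\<close> with the entries \<open>k\<close> and \<open>k + 1\<close> exchanged.\<close>

locale n_BiHom_Lie_color_algebra =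
  graded_vector_space K \<Gamma> L Lg + bicharacter K \<Gamma> \<epsilon>
  for K :: "('k, 'm) ring_scheme" and \<Gamma> :: "('g, 'l) monoid_scheme" and n :: nat
    and L :: "('k, 'v, 'p) module_scheme" and Lg :: "'g \<Rightarrow> 'v set"
    and br :: "'v list \<Rightarrow> 'v" and \<epsilon> :: "'g \<Rightarrow> 'g \<Rightarrow> 'k"
    and \<alpha> :: "'v \<Rightarrow> 'v" and \<beta> :: "'v \<Rightarrow> 'v" +
  assumes arity: "2 \<le> n"
    and bracket_multilinear: "multilinear_map K L n br"
    and bracket_even: "\<And>d x. (\<And>i. i \<in> {1..n} \<Longrightarrow> d i \<in> carrier \<Gamma> \<and> x i \<in> Lg (d i)) \<Longrightarrow>
      br (map x [1..<Suc n]) \<in> Lg (\<Otimes>\<^bsub>\<Gamma>\<^esub>i\<in>{1..n}. d i)"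
    and alpha_linear: "linear_map K L L \<alpha>"
    and alpha_even: "\<And>\<gamma> x. \<lbrakk>\<gamma> \<in> carrier \<Gamma>; x \<in> Lg \<gamma>\<rbrakk> \<Longrightarrow> \<alpha> x \<in> Lg \<gamma>"
    and beta_linear: "linear_map K L L \<beta>"
    and beta_even: "\<And>\<gamma> x. \<lbrakk>\<gamma> \<in> carrier \<Gamma>; x \<in> Lg \<gamma>\<rbrakk> \<Longrightarrow> \<beta> x \<in> Lg \<gamma>"
    and alpha_beta: "\<And>x. x \<in> carrier L \<Longrightarrow> \<alpha> (\<beta> x) = \<beta> (\<alpha> x)"
    and skew_symmetry:
      "\<And>d x k. \<lbrakk>\<And>i. i \<in> {1..n} \<Longrightarrow> d i \<in> carrier \<Gamma> \<and> x i \<in> Lg (d i); k \<in> {1..n - 1}\<rbrakk> \<Longrightarrow>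
        br (bihom_args n \<alpha> \<beta> x) =
          \<ominus>\<^bsub>L\<^esub> (\<epsilon> (d k) (d (k + 1)) \<odot>\<^bsub>L\<^esub>
            br (bihom_args n \<alpha> \<beta> (x \<circ> transpose k (k + 1))))"
    and jacobi:
      "\<And>d x e y. \<lbrakk>\<And>i. i \<in> {1..n - 1} \<Longrightarrow> d i \<in> carrier \<Gamma> \<and> x i \<in> Lg (d i);
                   \<And>i. i \<in> {1..n} \<Longrightarrow> e i \<in> carrier \<Gamma> \<and> y i \<in> Lg (e i)\<rbrakk> \<Longrightarrow>
        br (map (\<lambda>i. \<beta> (\<beta> (x i))) [1..<n] @ [br (bihom_args n \<alpha> \<beta> y)]) =
          (\<Oplus>\<^bsub>L\<^esub>k\<in>{1..n}.
            \<epsilon> (\<Otimes>\<^bsub>\<Gamma>\<^esub>i\<in>{1..n - 1}. d i) (\<Otimes>\<^bsub>\<Gamma>\<^esub>i\<in>{1..<k}. e i) \<odot>\<^bsub>L\<^esub>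
            br (map (\<lambda>i. \<beta> (\<beta> (y i))) [1..<k] @
                [br (bihom_args n \<alpha> \<beta> (x(n := y k)))] @
                map (\<lambda>i. \<beta> (\<beta> (y i))) [Suc k..<Suc n]))"

section \<open>Commutative associative algebras\<close>

text \<open>No unit is required: the field \<open>one A\<close> of the record is not constrained. The library's
  unital \<open>algebra\<close> is a special case.\<close>

locale comm_assoc_algebra =
  A?: module K A
  for K :: "('k, 'm) ring_scheme" and A :: "('k, 'a, 'p) module_scheme" +
  assumes alg_mult_closed: "\<lbrakk>a \<in> carrier A; b \<in> carrier A\<rbrakk> \<Longrightarrow> a \<otimes>\<^bsub>A\<^esub> b \<in> carrier A"
    and alg_mult_assoc: "\<lbrakk>a \<in> carrier A; b \<in> carrier A; c \<in> carrier A\<rbrakk> \<Longrightarrow>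
      (a \<otimes>\<^bsub>A\<^esub> b) \<otimes>\<^bsub>A\<^esub> c = a \<otimes>\<^bsub>A\<^esub> (b \<otimes>\<^bsub>A\<^esub> c)"
    and alg_mult_comm: "\<lbrakk>a \<in> carrier A; b \<in> carrier A\<rbrakk> \<Longrightarrow> a \<otimes>\<^bsub>A\<^esub> b = b \<otimes>\<^bsub>A\<^esub> a"
    and alg_distrib: "\<lbrakk>a \<in> carrier A; b \<in> carrier A; c \<in> carrier A\<rbrakk> \<Longrightarrow>
      (a \<oplus>\<^bsub>A\<^esub> b) \<otimes>\<^bsub>A\<^esub> c = a \<otimes>\<^bsub>A\<^esub> c \<oplus>\<^bsub>A\<^esub> b \<otimes>\<^bsub>A\<^esub> c"
    and alg_smult_assoc: "\<lbrakk>r \<in> carrier K; a \<in> carrier A; b \<in> carrier A\<rbrakk> \<Longrightarrow>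
      (r \<odot>\<^bsub>A\<^esub> a) \<otimes>\<^bsub>A\<^esub> b = r \<odot>\<^bsub>A\<^esub> (a \<otimes>\<^bsub>A\<^esub> b)"

lemma comm_assoc_algebra_if_algebra:
  assumes "algebra K A"
  shows "comm_assoc_algebra K A"
proof -
  interpret A: cring A using assms by (rule algebra.M_cring)
  show ?thesis
    using algebra.module[OF assms] algebra.smult_assoc2[OF assms]
    by (intro comm_assoc_algebra.intro comm_assoc_algebra_axioms.intro)
      (auto simp: A.m_assoc A.l_distr intro: A.m_comm)
qed

text \<open>Product of a nonempty list, defined without a unit element.\<close>

fun nonempty_prod :: "('a, 'm) ring_scheme \<Rightarrow> 'a list \<Rightarrow> 'a" where
  "nonempty_prod A [a] = a"
| "nonempty_prod A (a # b # as) = a \<otimes>\<^bsub>A\<^esub> nonempty_prod A (b # as)"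

section \<open>The tensor product of two modules\<close>

text \<open>\<open>M \<otimes>\<^sub>K N\<close> is the free \<open>K\<close>-module on \<open>carrier M \<times> carrier N\<close> (finitely supported functions)
  modulo the submodule generated by the bilinearity relations. The fields \<open>mult\<close> and \<open>one\<close> of
  the module records, which play no role for modules, are left unspecified.\<close>

definition free_module :: "('k, 'm) ring_scheme \<Rightarrow> 'b set \<Rightarrow> ('k, 'b \<Rightarrow> 'k) module"
  where "free_module K S =
    \<lparr>carrier = {f. f \<in> UNIV \<rightarrow> carrier K \<and> finite {p. f p \<noteq> \<zero>\<^bsub>K\<^esub>} \<and> {p. f p \<noteq> \<zero>\<^bsub>K\<^esub>} \<subseteq> S},
     monoid.mult = undefined, one = undefined,
     ring.zero = (\<lambda>p. \<zero>\<^bsub>K\<^esub>), add = (\<lambda>f g p. f p \<oplus>\<^bsub>K\<^esub> g p),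
     smult = (\<lambda>c f p. c \<otimes>\<^bsub>K\<^esub> f p)\<rparr>"

definition free_gen :: "('k, 'm) ring_scheme \<Rightarrow> 'b \<Rightarrow> 'b \<Rightarrow> 'k"
  where "free_gen K p = (\<lambda>q. if q = p then \<one>\<^bsub>K\<^esub> else \<zero>\<^bsub>K\<^esub>)"

definition generated_submodule ::
  "('k, 'm) ring_scheme \<Rightarrow> ('k, 'v, 'p) module_scheme \<Rightarrow> 'v set \<Rightarrow> 'v set"
  where "generated_submodule K V S = (\<lambda>N. submodule N K V) hull S"

definition quotient_module ::
  "('k, 'v, 'p) module_scheme \<Rightarrow> 'v set \<Rightarrow> ('k, 'v set) module"
  where "quotient_module V N =
    \<lparr>carrier = a_rcosets\<^bsub>V\<^esub> N, monoid.mult = undefined, one = undefined,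
     ring.zero = N, add = set_add V,
     smult = (\<lambda>c C. \<Union>x\<in>C. N +>\<^bsub>V\<^esub> (c \<odot>\<^bsub>V\<^esub> x))\<rparr>"

definition tensor_free ::
  "('k, 'm) ring_scheme \<Rightarrow> ('k, 'a, 'p) module_scheme \<Rightarrow> ('k, 'v, 'q) module_scheme \<Rightarrow>
    ('k, 'a \<times> 'v \<Rightarrow> 'k) module"
  where "tensor_free K M N = free_module K (carrier M \<times> carrier N)"

definition tensor_relations ::
  "('k, 'm) ring_scheme \<Rightarrow> ('k, 'a, 'p) module_scheme \<Rightarrow> ('k, 'v, 'q) module_scheme \<Rightarrow>
    ('a \<times> 'v \<Rightarrow> 'k) set"
  where "tensor_relations K M N =
    (let F = tensor_free K M N; g = (\<lambda>a x. free_gen K (a, x)) in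
      {g (a \<oplus>\<^bsub>M\<^esub> b) x \<ominus>\<^bsub>F\<^esub> (g a x \<oplus>\<^bsub>F\<^esub> g b x) | a b x.
         a \<in> carrier M \<and> b \<in> carrier M \<and> x \<in> carrier N} \<union>
      {g a (x \<oplus>\<^bsub>N\<^esub> y) \<ominus>\<^bsub>F\<^esub> (g a x \<oplus>\<^bsub>F\<^esub> g a y) | a x y.
         a \<in> carrier M \<and> x \<in> carrier N \<and> y \<in> carrier N} \<union>
      {g (c \<odot>\<^bsub>M\<^esub> a) x \<ominus>\<^bsub>F\<^esub> (c \<odot>\<^bsub>F\<^esub> g a x) | c a x.
         c \<in> carrier K \<and> a \<in> carrier M \<and> x \<in> carrier N} \<union>
      {g a (c \<odot>\<^bsub>N\<^esub> x) \<ominus>\<^bsub>F\<^esub> (c \<odot>\<^bsub>F\<^esub> g a x) | c a x.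
         c \<in> carrier K \<and> a \<in> carrier M \<and> x \<in> carrier N})"

definition tensor_kernel ::
  "('k, 'm) ring_scheme \<Rightarrow> ('k, 'a, 'p) module_scheme \<Rightarrow> ('k, 'v, 'q) module_scheme \<Rightarrow>
    ('a \<times> 'v \<Rightarrow> 'k) set"
  where "tensor_kernel K M N =
    generated_submodule K (tensor_free K M N) (tensor_relations K M N)"

definition tensor_module ::
  "('k, 'm) ring_scheme \<Rightarrow> ('k, 'a, 'p) module_scheme \<Rightarrow> ('k, 'v, 'q) module_scheme \<Rightarrow>
    ('k, ('a \<times> 'v \<Rightarrow> 'k) set) module"
  where "tensor_module K M N = quotient_module (tensor_free K M N) (tensor_kernel K M N)"

definition tensor_elem ::
  "('k, 'm) ring_scheme \<Rightarrow> ('k, 'a, 'p) module_scheme \<Rightarrow> ('k, 'v, 'q) module_scheme \<Rightarrow>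
    'a \<Rightarrow> 'v \<Rightarrow> ('a \<times> 'v \<Rightarrow> 'k) set"
  where "tensor_elem K M N a x =
    tensor_kernel K M N +>\<^bsub>tensor_free K M N\<^esub> free_gen K (a, x)"

section \<open>The structure on the tensor product of an algebra and a BiHom-Lie color algebra\<close>

text \<open>The component \<open>A \<otimes> L\<^sub>\<gamma>\<close>, as a submodule of \<open>A \<otimes> L\<close>.\<close>

definition tensor_grading ::
  "('k, 'm) ring_scheme \<Rightarrow> ('k, 'a, 'p) module_scheme \<Rightarrow> ('k, 'v, 'q) module_scheme \<Rightarrow>
    ('g \<Rightarrow> 'v set) \<Rightarrow> 'g \<Rightarrow> ('a \<times> 'v \<Rightarrow> 'k) set set"
  where "tensor_grading K A L Lg \<gamma> =
    generated_submodule K (tensor_module K A L)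
      {tensor_elem K A L a x | a x. a \<in> carrier A \<and> x \<in> Lg \<gamma>}"

text \<open>The operations on \<open>A \<otimes> L\<close> are given by their values on pure tensors; as these span,
  the (multi)linear extensions are unique (on the carrier).\<close>

definition tensor_operations ::
  "('k, 'm) ring_scheme \<Rightarrow> ('k, 'a, 'p) module_scheme \<Rightarrow> nat \<Rightarrow> ('k, 'v, 'q) module_scheme \<Rightarrow>
    ('v list \<Rightarrow> 'v) \<Rightarrow> ('v \<Rightarrow> 'v) \<Rightarrow> ('v \<Rightarrow> 'v) \<Rightarrow>
    (('a \<times> 'v \<Rightarrow> 'k) set list \<Rightarrow> ('a \<times> 'v \<Rightarrow> 'k) set) \<Rightarrow>
    (('a \<times> 'v \<Rightarrow> 'k) set \<Rightarrow> ('a \<times> 'v \<Rightarrow> 'k) set) \<Rightarrow>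
    (('a \<times> 'v \<Rightarrow> 'k) set \<Rightarrow> ('a \<times> 'v \<Rightarrow> 'k) set) \<Rightarrow> bool"
  where "tensor_operations K A n L br \<alpha> \<beta> br' \<alpha>' \<beta>' \<longleftrightarrow>
    multilinear_map K (tensor_module K A L) n br' \<and>
    (\<forall>as xs. length as = n \<and> set as \<subseteq> carrier A \<and> length xs = n \<and> set xs \<subseteq> carrier L \<longrightarrow>
      br' (map2 (tensor_elem K A L) as xs) = tensor_elem K A L (nonempty_prod A as) (br xs)) \<and>
    linear_map K (tensor_module K A L) (tensor_module K A L) \<alpha>' \<and>
    (\<forall>a\<in>carrier A. \<forall>x\<in>carrier L. \<alpha>' (tensor_elem K A L a x) = tensor_elem K A L a (\<alpha> x)) \<and>
    linear_map K (tensor_module K A L) (tensor_module K A L) \<beta>' \<and>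
    (\<forall>a\<in>carrier A. \<forall>x\<in>carrier L. \<beta>' (tensor_elem K A L a x) = tensor_elem K A L a (\<beta> x))"

end

theory Submission
  imports Defs "HOL-Library.Multiset"
begin

text \<open>
  Linear maps out of \<open>A \<otimes> L\<close> correspond to bilinear maps on \<open>A \<times> L\<close>; extending one slot at a time
  gives the \<open>n\<close>-linear bracket. The grading is a direct sum because the projections of \<open>L\<close> onto its
  components \<open>L\<^sub>\<gamma>\<close> induce maps \<open>id \<otimes> pr\<^sub>\<gamma>\<close> on \<open>A \<otimes> L\<close> that recover the summands of a decomposition.
  A homogeneous element of degree \<open>\<gamma>\<close> is a sum of pure tensors \<open>a \<otimes> x\<close> with \<open>x \<in> L\<^sub>\<gamma>\<close>. Both sides of each
  identity are linear in each argument, so it suffices to check it on pure tensors; there all terms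
  have the same first factor, as \<open>A\<close> is commutative, and the second factors satisfy the identity of \<open>L\<close>.
\<close>

section \<open>Linear maps\<close>

text \<open>Pure tensors satisfy linear relations, so an operation cannot simply be prescribed on
  them: existence rests on the universal property. For n slots the obstacle is that lifting one slot
  presupposes that the lift over the remaining slots depends bilinearly on the fixed pair, so
  several properties of the iterated lift have to be proved together. The axioms are then verified
  for arbitrary operations with the prescribed values, from multilinearity and those values alone.
  An identity can be reduced to pure tensors because its coefficients depend on chosen degrees,
  which stay fixed while the elements vary; they are constants during the extension. Scalars need no
  separate case there: c(a \<otimes> x) = (ca) \<otimes> x, so sums of pure tensors already form a
  submodule and additivity in each slot suffices. Since \<open>A\<close> may lack a unit, products
  are taken over nonempty lists, and associativity and commutativity are first brought into a form
  for such lists.\<close>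

lemma linear_mapI:
  assumes "\<And>x. x \<in> carrier V \<Longrightarrow> f x \<in> carrier W"
    and "\<And>x y. \<lbrakk>x \<in> carrier V; y \<in> carrier V\<rbrakk> \<Longrightarrow> f (x \<oplus>\<^bsub>V\<^esub> y) = f x \<oplus>\<^bsub>W\<^esub> f y"
    and "\<And>c x. \<lbrakk>c \<in> carrier K; x \<in> carrier V\<rbrakk> \<Longrightarrow> f (c \<odot>\<^bsub>V\<^esub> x) = c \<odot>\<^bsub>W\<^esub> f x"
  shows "linear_map K V W f"
  using assms by (auto simp: linear_map_def)

lemma linear_map_closed: "\<lbrakk>linear_map K V W f; x \<in> carrier V\<rbrakk> \<Longrightarrow> f x \<in> carrier W"
  by (auto simp: linear_map_def)

lemma linear_map_add:
  "\<lbrakk>linear_map K V W f; x \<in> carrier V; y \<in> carrier V\<rbrakk> \<Longrightarrow> f (x \<oplus>\<^bsub>V\<^esub> y) = f x \<oplus>\<^bsub>W\<^esub> f y"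
  by (auto simp: linear_map_def)

lemma linear_map_smult:
  "\<lbrakk>linear_map K V W f; c \<in> carrier K; x \<in> carrier V\<rbrakk> \<Longrightarrow> f (c \<odot>\<^bsub>V\<^esub> x) = c \<odot>\<^bsub>W\<^esub> f x"
  by (auto simp: linear_map_def)

text \<open>The module hypothesis keeps sums and multiples of carrier elements inside the carrier,
  where alone \<open>f\<close> and \<open>g\<close> are known to agree. It allows rewriting under a
  binder with equations that hold only on the carrier.\<close>

lemma linear_map_cong:
  assumes "module K V" and "\<And>x. x \<in> carrier V \<Longrightarrow> f x = g x"
  shows "linear_map K V W f \<longleftrightarrow> linear_map K V W g"
proof -
  interpret module K V by fact
  show ?thesis unfolding linear_map_def using assms(2) by (auto simp: Pi_iff)
qed

lemma linear_map_abelian_group_hom: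
  assumes "module K V" "module K W" "linear_map K V W f"
  shows "abelian_group_hom V W f"
proof -
  interpret V: module K V by fact
  interpret W: module K W by fact
  show ?thesis
    using assms(3)
    by (auto intro!: abelian_group_homI V.abelian_group_axioms W.abelian_group_axioms
        group_hom.intro V.a_group W.a_group group_hom_axioms.intro homI
        simp: linear_map_def)
qed

lemma linear_map_zero:
  "\<lbrakk>module K V; module K W; linear_map K V W f\<rbrakk> \<Longrightarrow> f \<zero>\<^bsub>V\<^esub> = \<zero>\<^bsub>W\<^esub>"
  by (rule abelian_group_hom.hom_zero[OF linear_map_abelian_group_hom])

lemma linear_map_minus:
  "\<lbrakk>module K V; module K W; linear_map K V W f; x \<in> carrier V\<rbrakk> \<Longrightarrow>
    f (\<ominus>\<^bsub>V\<^esub> x) = \<ominus>\<^bsub>W\<^esub> f x"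
  by (rule abelian_group_hom.hom_a_inv[OF linear_map_abelian_group_hom])

lemma linear_map_diff:
  assumes "module K V" "module K W" "linear_map K V W f" "x \<in> carrier V" "y \<in> carrier V"
  shows "f (x \<ominus>\<^bsub>V\<^esub> y) = f x \<ominus>\<^bsub>W\<^esub> f y"
proof -
  interpret V: module K V by fact
  show ?thesis
    using assms by (simp add: a_minus_def linear_map_add[OF assms(3)] linear_map_minus)
qed

lemma linear_map_finsum:
  assumes "module K V" "module K W" "linear_map K V W f" "finite I" "h \<in> I \<rightarrow> carrier V"
  shows "f (\<Oplus>\<^bsub>V\<^esub>i\<in>I. h i) = (\<Oplus>\<^bsub>W\<^esub>i\<in>I. f (h i))"
  using assms(4,5)
proof (induction I)
  interpret V: module K V by fact
  interpret W: module K W by fact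
  case empty
  then show ?case using linear_map_zero[OF assms(1-3)] by simp
next
  interpret V: module K V by fact
  interpret W: module K W by fact
  case (insert i I)
  then show ?case
    using linear_map_closed[OF assms(3)]
    by (simp add: Pi_iff linear_map_add[OF assms(3)])
qed

lemma linear_map_compose:
  "\<lbrakk>linear_map K U V f; linear_map K V W g\<rbrakk> \<Longrightarrow> linear_map K U W (\<lambda>x. g (f x))"
  by (auto simp: linear_map_def Pi_iff)

lemma linear_map_ident: "linear_map K V V (\<lambda>x. x)"
  by (auto simp: linear_map_def)

section \<open>Generated submodules\<close>

lemma (in module) generated_submodule_submodule:
  assumes "S \<subseteq> carrier M"
  shows "submodule (generated_submodule R M S) R M"
proof -
  let ?T = "{N. submodule N R M \<and> S \<subseteq> N}"
  \<comment> \<open>The hull is an intersection; if the family had no member it would be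
    \<open>UNIV\<close> and not a subset of the carrier.\<close>
  have carr: "carrier M \<in> ?T" using assms carrier_is_submodule by auto
  have sub: "submodule N R M" if "N \<in> ?T" for N using that by simp
  show ?thesis
    unfolding generated_submodule_def hull_def
  proof (rule submoduleI)
    show "\<Inter>?T \<subseteq> carrier M" using carr by blast
    show "\<zero>\<^bsub>M\<^esub> \<in> \<Inter>?T"
      using subgroup.one_closed[OF submodule.axioms(1)] by fastforce
  qed (auto intro: submoduleE)
qed

lemma generated_submodule_inc: "x \<in> S \<Longrightarrow> x \<in> generated_submodule K V S"
  unfolding generated_submodule_def by (rule hull_inc)

lemma generated_submodule_minimal:
  "\<lbrakk>S \<subseteq> N; submodule N K V\<rbrakk> \<Longrightarrow> generated_submodule K V S \<subseteq> N"
  unfolding generated_submodule_def by (rule hull_minimal)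

lemma submodule_zero: "submodule N K V \<Longrightarrow> \<zero>\<^bsub>V\<^esub> \<in> N"
  using subgroup.one_closed[OF submodule.axioms(1)] by fastforce

lemma submodule_add: "\<lbrakk>submodule N K V; x \<in> N; y \<in> N\<rbrakk> \<Longrightarrow> x \<oplus>\<^bsub>V\<^esub> y \<in> N"
  using subgroup.m_closed[OF submodule.axioms(1)] by fastforce

lemma submodule_carrier: "\<lbrakk>submodule N K V; x \<in> N\<rbrakk> \<Longrightarrow> x \<in> carrier V"
  using subgroup.subset[OF submodule.axioms(1)] by fastforce

text \<open>Together with minimality of the hull, this reduces vanishing on a generated submodule to
  vanishing on its generators.\<close>

lemma linear_map_kernel_submodule:
  assumes "module K V" "module K W" "linear_map K V W f"
  shows "submodule {x \<in> carrier V. f x = \<zero>\<^bsub>W\<^esub>} K V"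
proof -
  interpret V: module K V by fact
  interpret W: module K W by fact
  show ?thesis
    by (rule V.submoduleI)
      (auto simp: linear_map_zero[OF assms] linear_map_minus[OF assms]
        linear_map_add[OF assms(3)] linear_map_smult[OF assms(3)])
qed

section \<open>Free modules\<close>

lemma free_module_simps [simp]:
  "\<zero>\<^bsub>free_module K S\<^esub> = (\<lambda>p. \<zero>\<^bsub>K\<^esub>)"
  "f \<oplus>\<^bsub>free_module K S\<^esub> g = (\<lambda>p. f p \<oplus>\<^bsub>K\<^esub> g p)"
  "c \<odot>\<^bsub>free_module K S\<^esub> f = (\<lambda>p. c \<otimes>\<^bsub>K\<^esub> f p)"
  by (auto simp: free_module_def)

lemma free_module_carrier:
  "f \<in> carrier (free_module K S) \<longleftrightarrow>
    (\<forall>p. f p \<in> carrier K) \<and> finite {p. f p \<noteq> \<zero>\<^bsub>K\<^esub>} \<and> {p. f p \<noteq> \<zero>\<^bsub>K\<^esub>} \<subseteq> S"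
  by (auto simp: free_module_def)

lemma free_module_module:
  assumes "cring K"
  shows "module K (free_module K S)"
proof -
  interpret K: cring K by fact
  let ?F = "free_module K S"
  have add: "f \<oplus>\<^bsub>?F\<^esub> g \<in> carrier ?F" if "f \<in> carrier ?F" "g \<in> carrier ?F" for f g
  proof -
    have "{p. f p \<oplus>\<^bsub>K\<^esub> g p \<noteq> \<zero>\<^bsub>K\<^esub>} \<subseteq> {p. f p \<noteq> \<zero>\<^bsub>K\<^esub>} \<union> {p. g p \<noteq> \<zero>\<^bsub>K\<^esub>}" by auto
    from finite_subset[OF this] this that show ?thesis
      unfolding free_module_carrier by auto
  qed
  have smult: "c \<odot>\<^bsub>?F\<^esub> f \<in> carrier ?F" if "c \<in> carrier K" "f \<in> carrier ?F" for c f
  proof -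
    have "{p. c \<otimes>\<^bsub>K\<^esub> f p \<noteq> \<zero>\<^bsub>K\<^esub>} \<subseteq> {p. f p \<noteq> \<zero>\<^bsub>K\<^esub>}" using that(1) by auto
    with that show ?thesis
      unfolding free_module_carrier by (auto dest: finite_subset)
  qed
  have "\<exists>g\<in>carrier ?F. g \<oplus>\<^bsub>?F\<^esub> f = \<zero>\<^bsub>?F\<^esub>" if f: "f \<in> carrier ?F" for f
  proof
    \<comment> \<open>The negative is written as a scalar multiple so that \<open>smult\<close> also
      yields its membership in the carrier.\<close>
    show "(\<ominus>\<^bsub>K\<^esub> \<one>\<^bsub>K\<^esub>) \<odot>\<^bsub>?F\<^esub> f \<oplus>\<^bsub>?F\<^esub> f = \<zero>\<^bsub>?F\<^esub>"
      using f by (simp add: free_module_carrier K.l_minus K.l_neg)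
  qed (simp del: free_module_simps add: smult f)
  then have "abelian_group ?F"
    using add
    by (intro abelian_groupI) (auto simp: free_module_carrier K.a_ac)
  then show ?thesis
    using add smult
    by (intro moduleI assms)
      (auto simp: free_module_carrier K.l_distr K.r_distr K.m_assoc)
qed

lemma free_gen_closed: "\<lbrakk>cring K; p \<in> S\<rbrakk> \<Longrightarrow> free_gen K p \<in> carrier (free_module K S)"
  using finite_subset[of "{q. free_gen K p q \<noteq> \<zero>\<^bsub>K\<^esub>}" "{p}"]
  by (auto simp: free_module_carrier free_gen_def cring_def dest: ring.ring_simprules)

text \<open>Supports are finite, and deleting one point of the support splits off one multiple of a
  generator. This is the source of the fact that pure tensors span.\<close>

lemma free_module_induct [consumes 2, case_names zero add]:
  assumes "f \<in> carrier (free_module K S)" and "cring K"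
    and zero: "P (\<lambda>p. \<zero>\<^bsub>K\<^esub>)"
    and add: "\<And>c p f. \<lbrakk>c \<in> carrier K; p \<in> S; f \<in> carrier (free_module K S); P f\<rbrakk> \<Longrightarrow>
      P (c \<odot>\<^bsub>free_module K S\<^esub> free_gen K p \<oplus>\<^bsub>free_module K S\<^esub> f)"
  shows "P f"
proof -
  interpret K: cring K by fact
  \<comment> \<open>\<open>B\<close> is only required to contain the support; a point of
    \<open>B\<close> outside the support is then dropped without changing \<open>f\<close>.\<close>
  have "P f" if "finite B" "{p. f p \<noteq> \<zero>\<^bsub>K\<^esub>} \<subseteq> B" "f \<in> carrier (free_module K S)" for B f
    using that
  proof (induction B arbitrary: f)
    case empty
    then have "f = (\<lambda>p. \<zero>\<^bsub>K\<^esub>)" by auto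
    then show ?case using zero by simp
  next
    case (insert p B)
    show ?case
    proof (cases "f p = \<zero>\<^bsub>K\<^esub>")
      case True
      then show ?thesis using insert by (intro insert.IH) auto
    next
      case False
      let ?f = "f(p := \<zero>\<^bsub>K\<^esub>)"
      have sub: "{q. ?f q \<noteq> \<zero>\<^bsub>K\<^esub>} \<subseteq> {q. f q \<noteq> \<zero>\<^bsub>K\<^esub>}" by auto
      then have carr: "?f \<in> carrier (free_module K S)"
        using insert.prems by (auto simp: free_module_carrier simp del: fun_upd_apply dest: finite_subset)
          (auto simp: fun_upd_def)
      have "{q. ?f q \<noteq> \<zero>\<^bsub>K\<^esub>} \<subseteq> B" using insert.prems by auto
      then have "P ?f" using carr insert.IH by blast
      moreover have "f p \<in> carrier K" "p \<in> S"
        using insert.prems False by (auto simp: free_module_carrier)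
      moreover have "f = f p \<odot>\<^bsub>free_module K S\<^esub> free_gen K p \<oplus>\<^bsub>free_module K S\<^esub> ?f"
        using insert.prems by (auto simp: free_gen_def free_module_carrier)
      ultimately show ?thesis using add[of "f p" p ?f] carr by simp
    qed
  qed
  then show ?thesis using assms(1) by (auto simp: free_module_carrier)
qed

section \<open>Linear extension from the generators of a free module\<close>

definition free_lift ::
  "('k, 'm) ring_scheme \<Rightarrow> ('k, 'w, 'q) module_scheme \<Rightarrow> ('b \<Rightarrow> 'w) \<Rightarrow> ('b \<Rightarrow> 'k) \<Rightarrow> 'w"
  where "free_lift K W \<phi> f = (\<Oplus>\<^bsub>W\<^esub>p\<in>{p. f p \<noteq> \<zero>\<^bsub>K\<^esub>}. f p \<odot>\<^bsub>W\<^esub> \<phi> p)"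

text \<open>The defining sum runs over the exact support, which may shrink by cancellation when
  functions are added or scaled. A common finite superset lets the sums for different functions be
  compared term by term.\<close>

lemma free_lift_eq:
  assumes "module K W" "\<phi> \<in> S \<rightarrow> carrier W" "f \<in> carrier (free_module K S)"
    and "finite B" "{p. f p \<noteq> \<zero>\<^bsub>K\<^esub>} \<subseteq> B" "B \<subseteq> S"
  shows "free_lift K W \<phi> f = (\<Oplus>\<^bsub>W\<^esub>p\<in>B. f p \<odot>\<^bsub>W\<^esub> \<phi> p)"
proof -
  interpret W: module K W by fact
  show ?thesis
    unfolding free_lift_def
    using assms(2-)
    by (intro W.add.finprod_mono_neutral_cong_left)
      (auto simp: free_module_carrier Pi_iff subset_iff)
qed

lemma free_lift_linear:
  assumes "module K W" "\<phi> \<in> S \<rightarrow> carrier W"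
  shows "linear_map K (free_module K S) W (free_lift K W \<phi>)"
proof -
  interpret W: module K W by fact
  interpret F: module K "free_module K S" by (rule free_module_module) (rule W.is_cring)
  note eq = free_lift_eq[OF assms]
  show ?thesis
  proof (rule linear_mapI)
    fix f assume f: "f \<in> carrier (free_module K S)"
    then show "free_lift K W \<phi> f \<in> carrier W"
      using assms(2) unfolding free_lift_def free_module_carrier
      by (intro W.finsum_closed) (auto simp: Pi_iff)
  next
    fix f g assume f: "f \<in> carrier (free_module K S)" and g: "g \<in> carrier (free_module K S)"
    let ?B = "{p. f p \<noteq> \<zero>\<^bsub>K\<^esub>} \<union> {p. g p \<noteq> \<zero>\<^bsub>K\<^esub>}"
    have B: "finite ?B" "?B \<subseteq> S" using f g by (auto simp: free_module_carrier)
    have "{p. f p \<oplus>\<^bsub>K\<^esub> g p \<noteq> \<zero>\<^bsub>K\<^esub>} \<subseteq> ?B" by auto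
    then    have "free_lift K W \<phi> (f \<oplus>\<^bsub>free_module K S\<^esub> g) =
        (\<Oplus>\<^bsub>W\<^esub>p\<in>?B. (f p \<oplus>\<^bsub>K\<^esub> g p) \<odot>\<^bsub>W\<^esub> \<phi> p)"
      using eq[OF F.a_closed[OF f g] B(1) _ B(2)] by simp
    also have "\<dots> = (\<Oplus>\<^bsub>W\<^esub>p\<in>?B. f p \<odot>\<^bsub>W\<^esub> \<phi> p \<oplus>\<^bsub>W\<^esub> g p \<odot>\<^bsub>W\<^esub> \<phi> p)"
      using f g B assms(2)
      by (intro W.finsum_cong') (auto simp: free_module_carrier Pi_iff W.smult_l_distr subset_iff)
    also have "\<dots> = (\<Oplus>\<^bsub>W\<^esub>p\<in>?B. f p \<odot>\<^bsub>W\<^esub> \<phi> p) \<oplus>\<^bsub>W\<^esub> (\<Oplus>\<^bsub>W\<^esub>p\<in>?B. g p \<odot>\<^bsub>W\<^esub> \<phi> p)"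
      using f g B assms(2)
      by (intro W.finsum_addf) (auto simp: free_module_carrier Pi_iff subset_iff)
    also have "\<dots> = free_lift K W \<phi> f \<oplus>\<^bsub>W\<^esub> free_lift K W \<phi> g"
      using eq[OF f B(1)] eq[OF g B(1)] B by simp
    finally show "free_lift K W \<phi> (f \<oplus>\<^bsub>free_module K S\<^esub> g) =
      free_lift K W \<phi> f \<oplus>\<^bsub>W\<^esub> free_lift K W \<phi> g" .
  next
    fix c f assume c: "c \<in> carrier K" and f: "f \<in> carrier (free_module K S)"
    let ?B = "{p. f p \<noteq> \<zero>\<^bsub>K\<^esub>}"
    have B: "finite ?B" "?B \<subseteq> S" using f by (auto simp: free_module_carrier)
    have "{p. c \<otimes>\<^bsub>K\<^esub> f p \<noteq> \<zero>\<^bsub>K\<^esub>} \<subseteq> ?B" using c by auto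
    then have "free_lift K W \<phi> (c \<odot>\<^bsub>free_module K S\<^esub> f) =
        (\<Oplus>\<^bsub>W\<^esub>p\<in>?B. (c \<otimes>\<^bsub>K\<^esub> f p) \<odot>\<^bsub>W\<^esub> \<phi> p)"
      using eq[OF F.smult_closed[OF c f] B(1) _ B(2)] by simp
    also have "\<dots> = (\<Oplus>\<^bsub>W\<^esub>p\<in>?B. c \<odot>\<^bsub>W\<^esub> (f p \<odot>\<^bsub>W\<^esub> \<phi> p))"
      using c f B assms(2)
      by (intro W.finsum_cong') (auto simp: free_module_carrier Pi_iff W.smult_assoc1 subset_iff)
    also have "\<dots> = c \<odot>\<^bsub>W\<^esub> free_lift K W \<phi> f"
      unfolding free_lift_def using c f B assms(2)
      by (intro W.finsum_smult_ldistr[symmetric]) (auto simp: free_module_carrier Pi_iff subset_iff)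
    finally show "free_lift K W \<phi> (c \<odot>\<^bsub>free_module K S\<^esub> f) = c \<odot>\<^bsub>W\<^esub> free_lift K W \<phi> f" .
  qed
qed

lemma free_lift_gen:
  assumes "module K W" "\<phi> \<in> S \<rightarrow> carrier W" "p \<in> S"
  shows "free_lift K W \<phi> (free_gen K p) = \<phi> p"
proof -
  interpret W: module K W by fact
  have "free_lift K W \<phi> (free_gen K p) = (\<Oplus>\<^bsub>W\<^esub>q\<in>{p}. free_gen K p q \<odot>\<^bsub>W\<^esub> \<phi> q)"
    using assms free_gen_closed[OF W.is_cring]
    by (intro free_lift_eq) (auto simp: free_gen_def)
  also have "\<dots> = \<phi> p" using assms by (auto simp: free_gen_def Pi_iff)
  finally show ?thesis .
qed

section \<open>Quotient modules\<close>

locale module_with_submodule = module K V for K :: "('k, 'm) ring_scheme"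
    and V :: "('k, 'v, 'p) module_scheme" +
  fixes N :: "'v set"
  assumes submodule: "submodule N K V"
begin

sublocale abelian_subgroup N V
  by (intro abelian_subgroupI3 additive_subgroupI submodule.axioms(1)[OF submodule]
      abelian_group_axioms)

lemma coset_eq_iff:
  assumes "x \<in> carrier V" "y \<in> carrier V"
  shows "N +>\<^bsub>V\<^esub> x = N +>\<^bsub>V\<^esub> y \<longleftrightarrow> x \<ominus>\<^bsub>V\<^esub> y \<in> N"
proof
  assume "N +>\<^bsub>V\<^esub> x = N +>\<^bsub>V\<^esub> y"
  then have "x \<in> N +>\<^bsub>V\<^esub> y" using a_rcos_self[OF assms(1)] by simp
  then show "x \<ominus>\<^bsub>V\<^esub> y \<in> N" using assms a_rcos_module_imp by (simp add: a_minus_def)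
next
  assume "x \<ominus>\<^bsub>V\<^esub> y \<in> N"
  then have "x \<in> N +>\<^bsub>V\<^esub> y" using assms a_rcos_module_rev by (simp add: a_minus_def)
  then show "N +>\<^bsub>V\<^esub> x = N +>\<^bsub>V\<^esub> y"
    using a_repr_independence[OF _ assms(2) a_subgroup] by simp
qed

lemma quotient_carrier: "carrier (quotient_module V N) = (\<lambda>x. N +>\<^bsub>V\<^esub> x) ` carrier V"
  by (auto simp: quotient_module_def A_RCOSETS_def')

lemma quotient_add:
  "\<lbrakk>x \<in> carrier V; y \<in> carrier V\<rbrakk> \<Longrightarrow>
    (N +>\<^bsub>V\<^esub> x) \<oplus>\<^bsub>quotient_module V N\<^esub> (N +>\<^bsub>V\<^esub> y) = N +>\<^bsub>V\<^esub> (x \<oplus>\<^bsub>V\<^esub> y)"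
  by (simp add: quotient_module_def a_rcos_sum)

lemma quotient_zero: "\<zero>\<^bsub>quotient_module V N\<^esub> = N +>\<^bsub>V\<^esub> \<zero>\<^bsub>V\<^esub>"
  by (simp add: quotient_module_def a_coset_add_zero a_subset)

text \<open>The product is defined as a union of cosets over all members \<open>z\<close> of the
  given coset. All these cosets coincide, because c(z - x) lies in \<open>N\<close>, so the union
  collapses to one of them.\<close>

lemma quotient_smult:
  assumes c: "c \<in> carrier K" and x: "x \<in> carrier V"
  shows "c \<odot>\<^bsub>quotient_module V N\<^esub> (N +>\<^bsub>V\<^esub> x) = N +>\<^bsub>V\<^esub> (c \<odot>\<^bsub>V\<^esub> x)"
proof -
  have "N +>\<^bsub>V\<^esub> (c \<odot>\<^bsub>V\<^esub> z) = N +>\<^bsub>V\<^esub> (c \<odot>\<^bsub>V\<^esub> x)" if z: "z \<in> N +>\<^bsub>V\<^esub> x" for z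
  proof -
    have zV: "z \<in> carrier V" using z x a_r_coset_subset_G[OF a_subset x] by auto
    have "z \<ominus>\<^bsub>V\<^esub> x \<in> N" using z x a_rcos_module_imp zV by (simp add: a_minus_def)
    then have "c \<odot>\<^bsub>V\<^esub> (z \<ominus>\<^bsub>V\<^esub> x) \<in> N" using submodule.smult_closed[OF submodule] c by blast
    then have "c \<odot>\<^bsub>V\<^esub> z \<ominus>\<^bsub>V\<^esub> c \<odot>\<^bsub>V\<^esub> x \<in> N"
      using c x zV by (simp add: a_minus_def[of V] smult_r_distr smult_r_minus)
    then show ?thesis using coset_eq_iff c x zV by simp
  qed
  then show ?thesis
    unfolding quotient_module_def module.simps
    by (intro UN_constant_eq[OF a_rcos_self[OF x]]) blast
qed

lemma quotient_module_module: "module K (quotient_module V N)"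
proof (rule moduleI)
  let ?Q = "quotient_module V N"
  show "abelian_group ?Q"
  proof (rule abelian_groupI)
    fix C assume "C \<in> carrier ?Q"
    then obtain x where x: "x \<in> carrier V" "C = N +>\<^bsub>V\<^esub> x" by (auto simp: quotient_carrier)
    then have "(N +>\<^bsub>V\<^esub> (\<ominus>\<^bsub>V\<^esub> x)) \<oplus>\<^bsub>?Q\<^esub> C = \<zero>\<^bsub>?Q\<^esub>"
      by (simp add: quotient_add quotient_zero M.l_neg)
    then show "\<exists>D\<in>carrier ?Q. D \<oplus>\<^bsub>?Q\<^esub> C = \<zero>\<^bsub>?Q\<^esub>"
      using x by (auto simp: quotient_carrier)
  qed (auto simp: quotient_carrier quotient_add quotient_zero M.a_ac)
qed (auto simp: quotient_carrier quotient_add quotient_smult smult_l_distr smult_r_distr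
      smult_assoc1 is_cring)

lemma quotient_proj_linear: "linear_map K V (quotient_module V N) (\<lambda>x. N +>\<^bsub>V\<^esub> x)"
  by (rule linear_mapI) (auto simp: quotient_carrier quotient_add quotient_smult)

text \<open>The induced map evaluates \<open>f\<close> at a representative picked by
  \<open>SOME\<close>. The choice is irrelevant: two representatives differ by an element of
  \<open>N\<close>, where \<open>f\<close> vanishes.\<close>

lemma quotient_lift:
  assumes "module K W" "linear_map K V W f" and ker: "\<And>x. x \<in> N \<Longrightarrow> f x = \<zero>\<^bsub>W\<^esub>"
  shows "linear_map K (quotient_module V N) W (\<lambda>C. f (SOME x. x \<in> C))"
    and "x \<in> carrier V \<Longrightarrow> f (SOME z. z \<in> N +>\<^bsub>V\<^esub> x) = f x"
proof -
  interpret W: module K W by fact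
  have *: "f (SOME z. z \<in> N +>\<^bsub>V\<^esub> x) = f x" if x: "x \<in> carrier V" for x
  proof -
    let ?z = "SOME z. z \<in> N +>\<^bsub>V\<^esub> x"
    have z: "?z \<in> N +>\<^bsub>V\<^esub> x" using a_rcos_self[OF x] by (rule someI)
    then have zV: "?z \<in> carrier V" using a_r_coset_subset_G[OF a_subset x] by auto
    have "?z \<ominus>\<^bsub>V\<^esub> x \<in> N" using z x a_rcos_module_imp zV by (simp add: a_minus_def)
    then have "f ?z \<ominus>\<^bsub>W\<^esub> f x = \<zero>\<^bsub>W\<^esub>"
      using ker linear_map_diff[OF module_axioms assms(1,2) zV x] by simp
    then have "f ?z \<oplus>\<^bsub>W\<^esub> \<ominus>\<^bsub>W\<^esub> f x = \<zero>\<^bsub>W\<^esub>" by (simp add: a_minus_def)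
    from W.minus_equality[OF this] show ?thesis
      using linear_map_closed[OF assms(2)] zV x by simp
  qed
  then show "x \<in> carrier V \<Longrightarrow> f (SOME z. z \<in> N +>\<^bsub>V\<^esub> x) = f x" .
  show "linear_map K (quotient_module V N) W (\<lambda>C. f (SOME x. x \<in> C))"
    by (rule linear_mapI)
      (auto simp: quotient_carrier quotient_add quotient_smult *
        linear_map_closed[OF assms(2)] linear_map_add[OF assms(2)] linear_map_smult[OF assms(2)])
qed

end

section \<open>Tensor products\<close>

definition bilinear_map ::
  "('k, 'm) ring_scheme \<Rightarrow> ('k, 'a, 'p) module_scheme \<Rightarrow> ('k, 'v, 'q) module_scheme \<Rightarrow>
    ('k, 'w, 'r) module_scheme \<Rightarrow> ('a \<Rightarrow> 'v \<Rightarrow> 'w) \<Rightarrow> bool"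
  where "bilinear_map K M N W \<phi> \<longleftrightarrow>
    (\<forall>x\<in>carrier N. linear_map K M W (\<lambda>a. \<phi> a x)) \<and>
    (\<forall>a\<in>carrier M. linear_map K N W (\<phi> a))"

text \<open>The two factors are not parameters: the chosen representative carries its own finite
  support, over which \<open>free_lift\<close> sums.\<close>

definition tensor_lift ::
  "('k, 'm) ring_scheme \<Rightarrow> ('k, 'w, 'r) module_scheme \<Rightarrow> ('a \<Rightarrow> 'v \<Rightarrow> 'w) \<Rightarrow>
    ('a \<times> 'v \<Rightarrow> 'k) set \<Rightarrow> 'w"
  where "tensor_lift K W \<phi> C = free_lift K W (\<lambda>(a, x). \<phi> a x) (SOME f. f \<in> C)"

text \<open>Neither zero nor scalar multiples are generated, since for a submodule \<open>X\<close>
  both are obtained from the two rules. Inductions over homogeneous tensors therefore have just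
  these two cases.\<close>

inductive_set tensor_sums ::
  "('k, 'm) ring_scheme \<Rightarrow> ('k, 'a, 'p) module_scheme \<Rightarrow> ('k, 'v, 'q) module_scheme \<Rightarrow>
    'v set \<Rightarrow> ('a \<times> 'v \<Rightarrow> 'k) set set"
  for K M N X where
    pure: "\<lbrakk>a \<in> carrier M; x \<in> X\<rbrakk> \<Longrightarrow> tensor_elem K M N a x \<in> tensor_sums K M N X"
  | add: "\<lbrakk>s \<in> tensor_sums K M N X; t \<in> tensor_sums K M N X\<rbrakk> \<Longrightarrow>
      s \<oplus>\<^bsub>tensor_module K M N\<^esub> t \<in> tensor_sums K M N X"

locale tensor_product =
  M: module K M + N: module K N
  for K :: "('k, 'm) ring_scheme" and M :: "('k, 'a, 'p) module_scheme"
    and N :: "('k, 'v, 'q) module_scheme"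
begin

abbreviation "F \<equiv> tensor_free K M N"
abbreviation "T \<equiv> tensor_module K M N"
abbreviation "ker \<equiv> tensor_kernel K M N"
abbreviation pure (infix "\<otimes>\<otimes>" 75) where "a \<otimes>\<otimes> x \<equiv> tensor_elem K M N a x"

sublocale F: module K F
  unfolding tensor_free_def by (rule free_module_module) (rule M.is_cring)

lemma gen_closed: "\<lbrakk>a \<in> carrier M; x \<in> carrier N\<rbrakk> \<Longrightarrow> free_gen K (a, x) \<in> carrier F"
  unfolding tensor_free_def by (rule free_gen_closed[OF M.is_cring]) simp

lemma relations_closed: "tensor_relations K M N \<subseteq> carrier F"
  unfolding tensor_relations_def Let_def
  by (auto intro!: F.minus_closed F.a_closed F.smult_closed gen_closed)

sublocale Q: module_with_submodule K F ker
  unfolding tensor_kernel_def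
  by (intro module_with_submodule.intro module_with_submodule_axioms.intro F.module_axioms
      F.generated_submodule_submodule relations_closed)

sublocale T: module K T
  unfolding tensor_module_def by (rule Q.quotient_module_module)

lemma proj_linear: "linear_map K F T (\<lambda>f. ker +>\<^bsub>F\<^esub> f)"
  unfolding tensor_module_def by (rule Q.quotient_proj_linear)

lemma pure_closed: "\<lbrakk>a \<in> carrier M; x \<in> carrier N\<rbrakk> \<Longrightarrow> a \<otimes>\<otimes> x \<in> carrier T"
  unfolding tensor_elem_def using linear_map_closed[OF proj_linear] gen_closed by blast

lemma relation_imp_coset_eq:
  assumes "f \<ominus>\<^bsub>F\<^esub> g \<in> tensor_relations K M N" "f \<in> carrier F" "g \<in> carrier F"
  shows "ker +>\<^bsub>F\<^esub> f = ker +>\<^bsub>F\<^esub> g"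
  using assms Q.coset_eq_iff by (simp add: tensor_kernel_def generated_submodule_inc)

section \<open>The universal property of the tensor product\<close>

lemma bilinear_pure: "bilinear_map K M N T (\<otimes>\<otimes>)"
  unfolding bilinear_map_def
proof (intro conjI ballI linear_mapI)
  fix a b x assume c: "a \<in> carrier M" "b \<in> carrier M" "x \<in> carrier N"
  then have "ker +>\<^bsub>F\<^esub> free_gen K (a \<oplus>\<^bsub>M\<^esub> b, x) = ker +>\<^bsub>F\<^esub> (free_gen K (a, x) \<oplus>\<^bsub>F\<^esub> free_gen K (b, x))"
    by (intro relation_imp_coset_eq) (auto simp: tensor_relations_def gen_closed Let_def)
  with c show "(a \<oplus>\<^bsub>M\<^esub> b) \<otimes>\<otimes> x = a \<otimes>\<otimes> x \<oplus>\<^bsub>T\<^esub> b \<otimes>\<otimes> x"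
    by (simp add: tensor_elem_def linear_map_add[OF proj_linear gen_closed gen_closed])
next
  fix a x y assume c: "a \<in> carrier M" "x \<in> carrier N" "y \<in> carrier N"
  then have "ker +>\<^bsub>F\<^esub> free_gen K (a, x \<oplus>\<^bsub>N\<^esub> y) = ker +>\<^bsub>F\<^esub> (free_gen K (a, x) \<oplus>\<^bsub>F\<^esub> free_gen K (a, y))"
    by (intro relation_imp_coset_eq) (auto simp: tensor_relations_def gen_closed Let_def)
  with c show "a \<otimes>\<otimes> (x \<oplus>\<^bsub>N\<^esub> y) = a \<otimes>\<otimes> x \<oplus>\<^bsub>T\<^esub> a \<otimes>\<otimes> y"
    by (simp add: tensor_elem_def linear_map_add[OF proj_linear gen_closed gen_closed])
next
  fix c a x assume c: "c \<in> carrier K" "a \<in> carrier M" "x \<in> carrier N"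
  then have "ker +>\<^bsub>F\<^esub> free_gen K (c \<odot>\<^bsub>M\<^esub> a, x) = ker +>\<^bsub>F\<^esub> (c \<odot>\<^bsub>F\<^esub> free_gen K (a, x))"
    by (intro relation_imp_coset_eq) (auto simp: tensor_relations_def gen_closed Let_def)
  with c show "(c \<odot>\<^bsub>M\<^esub> a) \<otimes>\<otimes> x = c \<odot>\<^bsub>T\<^esub> (a \<otimes>\<otimes> x)"
    by (simp add: tensor_elem_def linear_map_smult[OF proj_linear _ gen_closed])
next
  fix c a x assume c: "c \<in> carrier K" "a \<in> carrier M" "x \<in> carrier N"
  then have "ker +>\<^bsub>F\<^esub> free_gen K (a, c \<odot>\<^bsub>N\<^esub> x) = ker +>\<^bsub>F\<^esub> (c \<odot>\<^bsub>F\<^esub> free_gen K (a, x))"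
    by (intro relation_imp_coset_eq) (auto simp: tensor_relations_def gen_closed Let_def)
  with c show "a \<otimes>\<otimes> (c \<odot>\<^bsub>N\<^esub> x) = c \<odot>\<^bsub>T\<^esub> (a \<otimes>\<otimes> x)"
    by (simp add: tensor_elem_def linear_map_smult[OF proj_linear _ gen_closed])
qed (auto intro: pure_closed)

lemma pure_linear_left: "x \<in> carrier N \<Longrightarrow> linear_map K M T (\<lambda>a. a \<otimes>\<otimes> x)"
  using bilinear_pure by (simp add: bilinear_map_def)

lemma pure_linear_right: "a \<in> carrier M \<Longrightarrow> linear_map K N T (\<lambda>x. a \<otimes>\<otimes> x)"
  using bilinear_pure by (simp add: bilinear_map_def)

text \<open>Bilinearity of \<open>\<phi>\<close> makes its linear extension to the free module kill
  the four families of relations, hence the submodule they generate, so the extension descends to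
  the quotient.\<close>

lemma
  assumes "module K W" "bilinear_map K M N W \<phi>"
  shows tensor_lift_linear: "linear_map K T W (tensor_lift K W \<phi>)"
    and tensor_lift_pure:
      "\<lbrakk>a \<in> carrier M; x \<in> carrier N\<rbrakk> \<Longrightarrow> tensor_lift K W \<phi> (a \<otimes>\<otimes> x) = \<phi> a x"
proof -
  interpret W: module K W by fact
  let ?f = "free_lift K W (\<lambda>(a, x). \<phi> a x)"
  have left: "linear_map K M W (\<lambda>a. \<phi> a x)" if "x \<in> carrier N" for x
    using assms(2) that by (simp add: bilinear_map_def)
  have right: "linear_map K N W (\<phi> a)" if "a \<in> carrier M" for a
    using assms(2) that by (simp add: bilinear_map_def)
  have closed: "\<phi> a x \<in> carrier W" if "a \<in> carrier M" "x \<in> carrier N" for a x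
    using linear_map_closed[OF left] that by blast
  then have Pi: "(\<lambda>(a, x). \<phi> a x) \<in> carrier M \<times> carrier N \<rightarrow> carrier W" by auto
  have lin: "linear_map K F W ?f"
    unfolding tensor_free_def by (rule free_lift_linear[OF assms(1) Pi])
  have gen: "?f (free_gen K (a, x)) = \<phi> a x" if "a \<in> carrier M" "x \<in> carrier N" for a x
    using free_lift_gen[OF assms(1) Pi] that by simp
  have "ker \<subseteq> {f \<in> carrier F. ?f f = \<zero>\<^bsub>W\<^esub>}"
    unfolding tensor_kernel_def
  proof (intro generated_submodule_minimal
      linear_map_kernel_submodule[OF F.module_axioms assms(1) lin] subsetI CollectI conjI)
    fix r assume r: "r \<in> tensor_relations K M N"
    then show "r \<in> carrier F" using relations_closed by blast
    \<comment> \<open>Every relation is a difference of two elements of the free module, so it is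
      enough that both have the same image.\<close>
    have eq: "?f (f \<ominus>\<^bsub>F\<^esub> g) = \<zero>\<^bsub>W\<^esub>" if "f \<in> carrier F" "g \<in> carrier F" "?f f = ?f g" for f g
      using that linear_map_diff[OF F.module_axioms assms(1) lin] linear_map_closed[OF lin]
      by (simp add: a_minus_def W.r_neg)
    show "?f r = \<zero>\<^bsub>W\<^esub>"
      using r unfolding tensor_relations_def Let_def
      by (auto intro!: eq F.a_closed F.smult_closed gen_closed
          simp: gen linear_map_add[OF lin gen_closed gen_closed] linear_map_smult[OF lin _ gen_closed]
            linear_map_add[OF left] linear_map_add[OF right]
            linear_map_smult[OF left] linear_map_smult[OF right])
  qed
  then have zero: "?f f = \<zero>\<^bsub>W\<^esub>" if "f \<in> ker" for f using that by blast
  have unfold: "tensor_lift K W \<phi> = (\<lambda>C. ?f (SOME f. f \<in> C))"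
    by (auto simp: tensor_lift_def)
  show "linear_map K T W (tensor_lift K W \<phi>)"
    unfolding tensor_module_def unfold by (rule Q.quotient_lift[OF assms(1) lin zero])
  show "tensor_lift K W \<phi> (a \<otimes>\<otimes> x) = \<phi> a x" if "a \<in> carrier M" "x \<in> carrier N"
    unfolding unfold tensor_elem_def
    using Q.quotient_lift(2)[OF assms(1) lin zero gen_closed] gen that by simp
qed

text \<open>A scalar moves into the first factor of each pure tensor, zero is the pure tensor of two
  zeros, and a negative is the multiple by -1.\<close>

lemma tensor_sums_submodule:
  assumes X: "submodule X K N"
  shows "submodule (tensor_sums K M N X) K T"
proof -
  note XN = submodule_carrier[OF X]
  have closed: "t \<in> carrier T" if "t \<in> tensor_sums K M N X" for t
    using that by induction (auto intro: pure_closed XN)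
  have smult: "c \<odot>\<^bsub>T\<^esub> t \<in> tensor_sums K M N X"
    if "t \<in> tensor_sums K M N X" "c \<in> carrier K" for c t
    using that
  proof induction
    case (pure a x)
    then have "c \<odot>\<^bsub>T\<^esub> (a \<otimes>\<otimes> x) = (c \<odot>\<^bsub>M\<^esub> a) \<otimes>\<otimes> x"
      using linear_map_smult[OF pure_linear_left] XN by simp
    then show ?case using pure by (auto intro: tensor_sums.pure)
  next
    case (add s t)
    then show ?case by (auto simp: T.smult_r_distr closed intro: tensor_sums.add)
  qed
  show ?thesis
  proof (rule T.submoduleI)
    have "\<zero>\<^bsub>M\<^esub> \<otimes>\<otimes> \<zero>\<^bsub>N\<^esub> = \<zero>\<^bsub>T\<^esub>"
      using linear_map_zero[OF M.module_axioms T.module_axioms pure_linear_left] by simp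
    then show "\<zero>\<^bsub>T\<^esub> \<in> tensor_sums K M N X"
      using tensor_sums.pure[of "\<zero>\<^bsub>M\<^esub>" M "\<zero>\<^bsub>N\<^esub>" X K N] submodule_zero[OF X] by simp
    show "\<ominus>\<^bsub>T\<^esub> t \<in> tensor_sums K M N X" if t: "t \<in> tensor_sums K M N X" for t
    proof -
      have "\<ominus>\<^bsub>T\<^esub> t = (\<ominus>\<^bsub>K\<^esub> \<one>\<^bsub>K\<^esub>) \<odot>\<^bsub>T\<^esub> t" using closed[OF t] by (simp add: T.smult_l_minus)
      then show ?thesis using smult[OF t] by simp
    qed
  qed (auto intro: closed smult tensor_sums.add)
qed

text \<open>It turns the hull that defines a graded component into a set with an induction
  principle.\<close>

lemma generated_submodule_pure:
  assumes X: "submodule X K N"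
  shows "generated_submodule K T {a \<otimes>\<otimes> x | a x. a \<in> carrier M \<and> x \<in> X} = tensor_sums K M N X"
    (is "generated_submodule K T ?S = _")
proof
  show "generated_submodule K T ?S \<subseteq> tensor_sums K M N X"
    by (intro generated_submodule_minimal tensor_sums_submodule X) (auto intro: tensor_sums.pure)
  have "?S \<subseteq> carrier T" using submodule_carrier[OF X] by (auto intro: pure_closed)
  then have sub: "submodule (generated_submodule K T ?S) K T"
    by (rule T.generated_submodule_submodule)
  show "tensor_sums K M N X \<subseteq> generated_submodule K T ?S"
  proof
    fix t assume "t \<in> tensor_sums K M N X"
    then show "t \<in> generated_submodule K T ?S"
      by induction (auto intro: generated_submodule_inc submodule_add[OF sub])
  qed
qed

text \<open>An element is the coset of a finite combination of generators, and the coset of a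
  multiple of the generator at (a, x) is again a pure tensor, with the coefficient absorbed by
  \<open>a\<close>.\<close>

lemma carrier_eq_tensor_sums: "carrier T = tensor_sums K M N (carrier N)"
proof
  have sub: "submodule (tensor_sums K M N (carrier N)) K T"
    by (rule tensor_sums_submodule[OF N.carrier_is_submodule])
  show "tensor_sums K M N (carrier N) \<subseteq> carrier T"
    using submodule_carrier[OF sub] by blast
  show "carrier T \<subseteq> tensor_sums K M N (carrier N)"
  proof
    fix t assume "t \<in> carrier T"
    then obtain f where f: "f \<in> carrier F" "t = ker +>\<^bsub>F\<^esub> f"
      unfolding tensor_module_def Q.quotient_carrier by auto
    have "ker +>\<^bsub>F\<^esub> f \<in> tensor_sums K M N (carrier N)"
      using f(1)[unfolded tensor_free_def] M.is_cring
    proof (induction rule: free_module_induct)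
      case zero
      have "ker +>\<^bsub>F\<^esub> \<zero>\<^bsub>F\<^esub> = \<zero>\<^bsub>T\<^esub>"
        by (rule linear_map_zero[OF F.module_axioms T.module_axioms proj_linear])
      then show ?case using submodule_zero[OF sub] by (simp add: tensor_free_def)
    next
      case (add c p f)
      obtain a x where p: "p = (a, x)" "a \<in> carrier M" "x \<in> carrier N" using add by auto
      have gen: "ker +>\<^bsub>F\<^esub> (c \<odot>\<^bsub>F\<^esub> free_gen K p) = (c \<odot>\<^bsub>M\<^esub> a) \<otimes>\<otimes> x"
        using p add linear_map_smult[OF proj_linear _ gen_closed]
          linear_map_smult[OF pure_linear_left] by (simp add: tensor_elem_def del: free_module_simps)
      have "ker +>\<^bsub>F\<^esub> (c \<odot>\<^bsub>F\<^esub> free_gen K p \<oplus>\<^bsub>F\<^esub> f) =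
          (c \<odot>\<^bsub>M\<^esub> a) \<otimes>\<otimes> x \<oplus>\<^bsub>T\<^esub> (ker +>\<^bsub>F\<^esub> f)"
        using p add linear_map_add[OF proj_linear, of "c \<odot>\<^bsub>F\<^esub> free_gen K p" f]
        by (simp add: gen[unfolded p(1)] gen_closed tensor_free_def[symmetric] del: free_module_simps)
      then show ?case
        using add p by (auto simp: tensor_free_def[symmetric] simp del: free_module_simps
            intro: tensor_sums.intros)
    qed
    then show "t \<in> tensor_sums K M N (carrier N)" using f by simp
  qed
qed

text \<open>This is the uniqueness half of the universal property, a consequence of the spanning by
  pure tensors.\<close>

lemma linear_map_eqI:
  assumes "linear_map K T W f" "linear_map K T W g"
    and "\<And>a x. \<lbrakk>a \<in> carrier M; x \<in> carrier N\<rbrakk> \<Longrightarrow> f (a \<otimes>\<otimes> x) = g (a \<otimes>\<otimes> x)"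
    and "t \<in> carrier T"
  shows "f t = g t"
proof -
  have "t \<in> tensor_sums K M N (carrier N)" using assms(4) carrier_eq_tensor_sums by simp
  then show ?thesis
  proof induction
    case (add s t)
    then show ?case
      using linear_map_add[OF assms(1), of s t] linear_map_add[OF assms(2), of s t]
      by (simp add: carrier_eq_tensor_sums)
  qed (use assms(3) in auto)
qed

end

section \<open>Multilinear maps on tensor products\<close>

lemma linear_map_sum:
  assumes "module K V" "module K W" "linear_map K V W f" "linear_map K V W g"
  shows "linear_map K V W (\<lambda>x. f x \<oplus>\<^bsub>W\<^esub> g x)"
proof -
  interpret W: module K W by fact
  note cl = linear_map_closed[OF assms(3)] linear_map_closed[OF assms(4)]
  show ?thesis
    by (rule linear_mapI)
      (simp_all add: cl linear_map_add[OF assms(3)] linear_map_add[OF assms(4)]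
        linear_map_smult[OF assms(3)] linear_map_smult[OF assms(4)] W.smult_r_distr W.M.a_ac)
qed

lemma linear_map_scale:
  assumes "module K V" "module K W" "linear_map K V W f" "c \<in> carrier K"
  shows "linear_map K V W (\<lambda>x. c \<odot>\<^bsub>W\<^esub> f x)"
proof -
  interpret W: module K W by fact
  note cl = linear_map_closed[OF assms(3)]
  show ?thesis
  proof (rule linear_mapI)
    fix d x assume dx: "d \<in> carrier K" "x \<in> carrier V"
    have "c \<odot>\<^bsub>W\<^esub> f (d \<odot>\<^bsub>V\<^esub> x) = c \<odot>\<^bsub>W\<^esub> (d \<odot>\<^bsub>W\<^esub> f x)"
      by (simp only: linear_map_smult[OF assms(3) dx])
    also have "\<dots> = (c \<otimes>\<^bsub>K\<^esub> d) \<odot>\<^bsub>W\<^esub> f x"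
      by (rule W.smult_assoc1[OF assms(4) dx(1) cl[OF dx(2)], symmetric])
    also have "\<dots> = (d \<otimes>\<^bsub>K\<^esub> c) \<odot>\<^bsub>W\<^esub> f x"
      by (simp only: W.R.m_comm[OF assms(4) dx(1)])
    also have "\<dots> = d \<odot>\<^bsub>W\<^esub> (c \<odot>\<^bsub>W\<^esub> f x)"
      by (rule W.smult_assoc1[OF dx(1) assms(4) cl[OF dx(2)]])
    finally show "c \<odot>\<^bsub>W\<^esub> f (d \<odot>\<^bsub>V\<^esub> x) = d \<odot>\<^bsub>W\<^esub> (c \<odot>\<^bsub>W\<^esub> f x)" .
  qed (use assms(4) in \<open>simp_all add: cl linear_map_add[OF assms(3)] W.smult_r_distr\<close>)
qed

text \<open>Iterated currying: the first slot is lifted from the function that sends a pair to the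
  lift over the remaining slots with this pair fixed. The given function takes pairs because its
  values are known on pure tensors only.\<close>

fun multi_lift ::
  "('k, 'm) ring_scheme \<Rightarrow> ('k, 'w, 'r) module_scheme \<Rightarrow> (('a \<times> 'v) list \<Rightarrow> 'w) \<Rightarrow>
    ('a \<times> 'v \<Rightarrow> 'k) set list \<Rightarrow> 'w"
  where
    "multi_lift K W g [] = g []"
  | "multi_lift K W g (t # ts) =
      tensor_lift K W (\<lambda>a x. multi_lift K W (\<lambda>ps. g ((a, x) # ps)) ts) t"

text \<open>Equivalently, linearity in each of the 2n entries separately.\<close>

definition multibilinear ::
  "('k, 'm) ring_scheme \<Rightarrow> ('k, 'a, 'p) module_scheme \<Rightarrow> ('k, 'v, 'q) module_scheme \<Rightarrow>
    ('k, 'w, 'r) module_scheme \<Rightarrow> nat \<Rightarrow> (('a \<times> 'v) list \<Rightarrow> 'w) \<Rightarrow> bool"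
  where "multibilinear K M N W n g \<longleftrightarrow>
    (\<forall>ps. length ps = n \<and> set ps \<subseteq> carrier M \<times> carrier N \<longrightarrow>
      g ps \<in> carrier W \<and>
      (\<forall>i<n. bilinear_map K M N W (\<lambda>a x. g (ps[i := (a, x)]))))"

lemma multibilinear_Cons:
  assumes "multibilinear K M N W (Suc n) g" "a \<in> carrier M" "x \<in> carrier N"
  shows "multibilinear K M N W n (\<lambda>ps. g ((a, x) # ps))"
  unfolding multibilinear_def
proof (intro allI impI conjI)
  fix ps assume ps: "length ps = n \<and> set ps \<subseteq> carrier M \<times> carrier N"
  then have ps': "length ((a, x) # ps) = Suc n" "set ((a, x) # ps) \<subseteq> carrier M \<times> carrier N"
    using assms by auto
  then show "g ((a, x) # ps) \<in> carrier W" using assms(1) unfolding multibilinear_def by blast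
  fix i assume "i < n"
  then have "bilinear_map K M N W (\<lambda>b y. g (((a, x) # ps)[Suc i := (b, y)]))"
    using assms(1) ps' unfolding multibilinear_def by (metis Suc_less_eq)
  then show "bilinear_map K M N W (\<lambda>b y. g ((a, x) # ps[i := (b, y)]))" by simp
qed

lemma multibilinear_head:
  assumes "multibilinear K M N W (Suc n) g" "module K M" "module K N"
    and "length ps = n" "set ps \<subseteq> carrier M \<times> carrier N"
  shows "bilinear_map K M N W (\<lambda>a x. g ((a, x) # ps))"
proof -
  interpret M: module K M by fact
  interpret N: module K N by fact
  \<comment> \<open>Multibilinearity speaks of replacing an entry in a list of full length; the zero
    pair is a placeholder for the head about to be replaced.\<close>
  let ?ps = "(\<zero>\<^bsub>M\<^esub>, \<zero>\<^bsub>N\<^esub>) # ps"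
  have "bilinear_map K M N W (\<lambda>a x. g (?ps[0 := (a, x)]))"
    using assms(1)[unfolded multibilinear_def, rule_format, of ?ps] assms(4,5) by auto
  then show ?thesis by simp
qed

context tensor_product
begin

text \<open>Additivity in the bilinear map rather than in the tensor; it is needed when a later slot
  of \<open>multi_lift\<close> varies. As \<open>\<chi>\<close> is known only on the carriers, the
  proof compares both sides on pure tensors instead of rewriting \<open>\<chi>\<close>.\<close>

lemma tensor_lift_add:
  assumes "module K W" "bilinear_map K M N W \<phi>" "bilinear_map K M N W \<psi>" "bilinear_map K M N W \<chi>"
    and "\<And>a x. \<lbrakk>a \<in> carrier M; x \<in> carrier N\<rbrakk> \<Longrightarrow> \<chi> a x = \<phi> a x \<oplus>\<^bsub>W\<^esub> \<psi> a x"
    and "t \<in> carrier T"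
  shows "tensor_lift K W \<chi> t = tensor_lift K W \<phi> t \<oplus>\<^bsub>W\<^esub> tensor_lift K W \<psi> t"
  by (rule linear_map_eqI[OF tensor_lift_linear[OF assms(1,4)]
        linear_map_sum[OF T.module_axioms assms(1) tensor_lift_linear[OF assms(1,2)]
          tensor_lift_linear[OF assms(1,3)]] _ assms(6)])
    (simp add: tensor_lift_pure[OF assms(1)] assms(2-5))

lemma tensor_lift_smult:
  assumes "module K W" "bilinear_map K M N W \<phi>" "bilinear_map K M N W \<chi>" "c \<in> carrier K"
    and "\<And>a x. \<lbrakk>a \<in> carrier M; x \<in> carrier N\<rbrakk> \<Longrightarrow> \<chi> a x = c \<odot>\<^bsub>W\<^esub> \<phi> a x"
    and "t \<in> carrier T"
  shows "tensor_lift K W \<chi> t = c \<odot>\<^bsub>W\<^esub> tensor_lift K W \<phi> t"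
  by (rule linear_map_eqI[OF tensor_lift_linear[OF assms(1,3)]
        linear_map_scale[OF T.module_axioms assms(1) tensor_lift_linear[OF assms(1,2)] assms(4)] _ assms(6)])
    (simp add: tensor_lift_pure[OF assms(1)] assms(2-5))

text \<open>The four claims depend on each other. Lifting the first slot requires a bilinear map,
  and its bilinearity means that the lift over the tail is additive and homogeneous in the function.
  Conversely, to transport additivity and homogeneity past one more slot, the functions lifted there
  must already be bilinear.\<close>

lemma
  assumes W: "module K W" and "set ts \<subseteq> carrier T"
  shows multi_lift_closed: "multibilinear K M N W (length ts) g \<Longrightarrow> multi_lift K W g ts \<in> carrier W"
    and multi_lift_add_fun: "\<lbrakk>multibilinear K M N W (length ts) g; multibilinear K M N W (length ts) h;
        multibilinear K M N W (length ts) k;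
        \<And>ps. \<lbrakk>length ps = length ts; set ps \<subseteq> carrier M \<times> carrier N\<rbrakk> \<Longrightarrow>
          k ps = g ps \<oplus>\<^bsub>W\<^esub> h ps\<rbrakk> \<Longrightarrow>
      multi_lift K W k ts = multi_lift K W g ts \<oplus>\<^bsub>W\<^esub> multi_lift K W h ts"
    and multi_lift_smult_fun: "\<lbrakk>multibilinear K M N W (length ts) g; multibilinear K M N W (length ts) k; c \<in> carrier K;
        \<And>ps. \<lbrakk>length ps = length ts; set ps \<subseteq> carrier M \<times> carrier N\<rbrakk> \<Longrightarrow>
          k ps = c \<odot>\<^bsub>W\<^esub> g ps\<rbrakk> \<Longrightarrow>
      multi_lift K W k ts = c \<odot>\<^bsub>W\<^esub> multi_lift K W g ts"
    and multi_lift_bilinear: "multibilinear K M N W (Suc (length ts)) k \<Longrightarrow>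
      bilinear_map K M N W (\<lambda>a x. multi_lift K W (\<lambda>ps. k ((a, x) # ps)) ts)"
  using assms(2)
proof (induction ts arbitrary: g h k c)
  note heads = multibilinear_head[OF _ M.module_axioms N.module_axioms]
  case Nil
  { case 1 then show ?case by (simp add: multibilinear_def) }
  { case 2 then show ?case by simp }
  { case 3 then show ?case by simp }
  { case 4 then show ?case using heads[where ps = "[]" and n = 0] by simp }
next
  note heads = multibilinear_head[OF _ M.module_axioms N.module_axioms]
  case (Cons t ts)
  have t: "t \<in> carrier T" and ts: "set ts \<subseteq> carrier T" if "set (t # ts) \<subseteq> carrier T"
    using that by auto
  have bil: "bilinear_map K M N W (\<lambda>a x. multi_lift K W (\<lambda>ps. k ((a, x) # ps)) ts)"
    if "multibilinear K M N W (length (t # ts)) k" "set (t # ts) \<subseteq> carrier T" for k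
    using Cons.IH(4) that by simp
  have cl: "multi_lift K W k (t # ts) \<in> carrier W"
    if "multibilinear K M N W (length (t # ts)) k" "set (t # ts) \<subseteq> carrier T" for k
    using linear_map_closed[OF tensor_lift_linear[OF W bil[OF that]] t[OF that(2)]] by simp
  have ad: "multi_lift K W k (t # ts) = multi_lift K W g (t # ts) \<oplus>\<^bsub>W\<^esub> multi_lift K W h (t # ts)"
    if g: "multibilinear K M N W (length (t # ts)) g" and h: "multibilinear K M N W (length (t # ts)) h"
      and k: "multibilinear K M N W (length (t # ts)) k"
      and eq: "\<And>ps. \<lbrakk>length ps = length (t # ts); set ps \<subseteq> carrier M \<times> carrier N\<rbrakk> \<Longrightarrow>
          k ps = g ps \<oplus>\<^bsub>W\<^esub> h ps" and T: "set (t # ts) \<subseteq> carrier T" for g h k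
    unfolding multi_lift.simps
  proof (rule tensor_lift_add[OF W bil[OF g T] bil[OF h T] bil[OF k T] _ t[OF T]])
    fix a x assume ax: "a \<in> carrier M" "x \<in> carrier N"
    show "multi_lift K W (\<lambda>ps. k ((a, x) # ps)) ts =
        multi_lift K W (\<lambda>ps. g ((a, x) # ps)) ts \<oplus>\<^bsub>W\<^esub> multi_lift K W (\<lambda>ps. h ((a, x) # ps)) ts"
      using g h k ax ts[OF T] by (intro Cons.IH(2) multibilinear_Cons eq) auto
  qed
  have sm: "multi_lift K W k (t # ts) = c \<odot>\<^bsub>W\<^esub> multi_lift K W g (t # ts)"
    if g: "multibilinear K M N W (length (t # ts)) g"
      and k: "multibilinear K M N W (length (t # ts)) k" and c: "c \<in> carrier K"
      and eq: "\<And>ps. \<lbrakk>length ps = length (t # ts); set ps \<subseteq> carrier M \<times> carrier N\<rbrakk> \<Longrightarrow>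
          k ps = c \<odot>\<^bsub>W\<^esub> g ps" and T: "set (t # ts) \<subseteq> carrier T" for g k c
    unfolding multi_lift.simps
  proof (rule tensor_lift_smult[OF W bil[OF g T] bil[OF k T] c _ t[OF T]])
    fix a x assume ax: "a \<in> carrier M" "x \<in> carrier N"
    show "multi_lift K W (\<lambda>ps. k ((a, x) # ps)) ts =
        c \<odot>\<^bsub>W\<^esub> multi_lift K W (\<lambda>ps. g ((a, x) # ps)) ts"
      using g k c ax ts[OF T] by (intro Cons.IH(3) multibilinear_Cons eq) auto
  qed
  { case 1 then show ?case by (rule cl) }
  { case 2 then show ?case by (rule ad) }
  { case 3 then show ?case by (rule sm) }
  \<comment> \<open>Here a pair stands in front of the whole list \<open>t # ts\<close>. Since
    \<open>k\<close> is bilinear in its head, varying the pair varies the function on the tail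
    linearly, and \<open>ad\<close> and \<open>sm\<close> carry this through the lift over
    \<open>t # ts\<close>.\<close>
  { case (4 k)
    note T = 4(2)
    note mb = multibilinear_Cons[OF 4(1)]
    have head: "bilinear_map K M N W (\<lambda>a x. k ((a, x) # ps))"
      if "length ps = length (t # ts)" "set ps \<subseteq> carrier M \<times> carrier N" for ps
      using heads[OF 4(1) that] .
    have left: "linear_map K M W (\<lambda>a. k ((a, x) # ps))"
      if "length ps = length (t # ts)" "set ps \<subseteq> carrier M \<times> carrier N" "x \<in> carrier N" for ps x
      using head[OF that(1,2)] that(3) by (simp add: bilinear_map_def)
    have right: "linear_map K N W (\<lambda>x. k ((a, x) # ps))"
      if "length ps = length (t # ts)" "set ps \<subseteq> carrier M \<times> carrier N" "a \<in> carrier M" for ps a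
      using head[OF that(1,2)] that(3) by (simp add: bilinear_map_def)
    show ?case
      unfolding bilinear_map_def
    proof (intro conjI ballI linear_mapI)
      fix a b x assume "a \<in> carrier M" "b \<in> carrier M" "x \<in> carrier N"
      then show "multi_lift K W (\<lambda>ps. k ((a \<oplus>\<^bsub>M\<^esub> b, x) # ps)) (t # ts) =
          multi_lift K W (\<lambda>ps. k ((a, x) # ps)) (t # ts) \<oplus>\<^bsub>W\<^esub>
          multi_lift K W (\<lambda>ps. k ((b, x) # ps)) (t # ts)"
        by (intro ad mb T linear_map_add[OF left]) auto
    next
      fix c a x assume "c \<in> carrier K" "a \<in> carrier M" "x \<in> carrier N"
      then show "multi_lift K W (\<lambda>ps. k ((c \<odot>\<^bsub>M\<^esub> a, x) # ps)) (t # ts) =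
          c \<odot>\<^bsub>W\<^esub> multi_lift K W (\<lambda>ps. k ((a, x) # ps)) (t # ts)"
        by (intro sm mb T linear_map_smult[OF left]) auto
    next
      fix a x y assume "a \<in> carrier M" "x \<in> carrier N" "y \<in> carrier N"
      then show "multi_lift K W (\<lambda>ps. k ((a, x \<oplus>\<^bsub>N\<^esub> y) # ps)) (t # ts) =
          multi_lift K W (\<lambda>ps. k ((a, x) # ps)) (t # ts) \<oplus>\<^bsub>W\<^esub>
          multi_lift K W (\<lambda>ps. k ((a, y) # ps)) (t # ts)"
        by (intro ad mb T linear_map_add[OF right]) auto
    next
      fix c a x assume "c \<in> carrier K" "a \<in> carrier M" "x \<in> carrier N"
      then show "multi_lift K W (\<lambda>ps. k ((a, c \<odot>\<^bsub>N\<^esub> x) # ps)) (t # ts) =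
          c \<odot>\<^bsub>W\<^esub> multi_lift K W (\<lambda>ps. k ((a, x) # ps)) (t # ts)"
        by (intro sm mb T linear_map_smult[OF right]) auto
    qed (rule cl[OF mb T]; assumption)+ }
qed

text \<open>In the first slot this is linearity of \<open>tensor_lift\<close>. A later slot affects
  only the bilinear map being lifted; by induction that map varies linearly, and the lift is linear
  in the map.\<close>

lemma multi_lift_linear:
  assumes W: "module K W" and "multibilinear K M N W (length ts) g"
    and "set ts \<subseteq> carrier T" and "i < length ts"
  shows "linear_map K T W (\<lambda>t. multi_lift K W g (ts[i := t]))"
  using assms(2-)
proof (induction ts arbitrary: g i)
  case (Cons t ts)
  have ts: "set ts \<subseteq> carrier T" and t: "t \<in> carrier T" using Cons.prems by auto
  have g: "multibilinear K M N W (Suc (length ts)) g" using Cons.prems by simp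
  show ?case
  proof (cases i)
    case 0
    then show ?thesis
      using tensor_lift_linear[OF W multi_lift_bilinear[OF W ts g]] by simp
  next
    case (Suc j)
    then have j: "j < length ts" using Cons.prems by simp
    have bil: "bilinear_map K M N W (\<lambda>a x. multi_lift K W (\<lambda>ps. g ((a, x) # ps)) (ts[j := s]))"
      if "s \<in> carrier T" for s
      using that ts g set_update_subset_insert[of ts j s] by (intro multi_lift_bilinear W) auto
    have lin: "linear_map K T W (\<lambda>s. multi_lift K W (\<lambda>ps. g ((a, x) # ps)) (ts[j := s]))"
      if "a \<in> carrier M" "x \<in> carrier N" for a x
      using Cons.IH[OF multibilinear_Cons[OF g that] ts j] .
    have "linear_map K T W (\<lambda>s. tensor_lift K W
        (\<lambda>a x. multi_lift K W (\<lambda>ps. g ((a, x) # ps)) (ts[j := s])) t)"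
    proof (rule linear_mapI)
      fix r s assume rs: "r \<in> carrier T" "s \<in> carrier T"
      show "tensor_lift K W (\<lambda>a x. multi_lift K W (\<lambda>ps. g ((a, x) # ps)) (ts[j := r \<oplus>\<^bsub>T\<^esub> s])) t =
        tensor_lift K W (\<lambda>a x. multi_lift K W (\<lambda>ps. g ((a, x) # ps)) (ts[j := r])) t \<oplus>\<^bsub>W\<^esub>
        tensor_lift K W (\<lambda>a x. multi_lift K W (\<lambda>ps. g ((a, x) # ps)) (ts[j := s])) t"
        by (rule tensor_lift_add[OF W bil[OF rs(1)] bil[OF rs(2)] bil[OF T.a_closed[OF rs]] _ t])
          (rule linear_map_add[OF lin rs])
    next
      fix c s assume cs: "c \<in> carrier K" "s \<in> carrier T"
      show "tensor_lift K W (\<lambda>a x. multi_lift K W (\<lambda>ps. g ((a, x) # ps)) (ts[j := c \<odot>\<^bsub>T\<^esub> s])) t =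
        c \<odot>\<^bsub>W\<^esub> tensor_lift K W (\<lambda>a x. multi_lift K W (\<lambda>ps. g ((a, x) # ps)) (ts[j := s])) t"
        by (rule tensor_lift_smult[OF W bil[OF cs(2)] bil[OF T.smult_closed[OF cs]] cs(1) _ t])
          (rule linear_map_smult[OF lin cs])
    qed (rule linear_map_closed[OF tensor_lift_linear[OF W bil] t])
    then show ?thesis using Suc by simp
  qed
qed simp

lemma multi_lift_pure:
  assumes W: "module K W" and "multibilinear K M N W (length ps) g"
    and "set ps \<subseteq> carrier M \<times> carrier N"
  shows "multi_lift K W g (map (\<lambda>(a, x). a \<otimes>\<otimes> x) ps) = g ps"
  using assms(2-)
proof (induction ps arbitrary: g)
  case (Cons p ps)
  obtain a x where p: "p = (a, x)" "a \<in> carrier M" "x \<in> carrier N" using Cons.prems by auto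
  have g: "multibilinear K M N W (Suc (length ps)) g" using Cons.prems by simp
  have "set (map (\<lambda>(a, x). a \<otimes>\<otimes> x) ps) \<subseteq> carrier T"
    using Cons.prems by (auto intro: pure_closed)
  from multi_lift_bilinear[OF W this, of g] g
  have "bilinear_map K M N W
      (\<lambda>a x. multi_lift K W (\<lambda>ps. g ((a, x) # ps)) (map (\<lambda>(a, x). a \<otimes>\<otimes> x) ps))" by simp
  from tensor_lift_pure[OF W this p(2,3)] Cons.IH[OF multibilinear_Cons[OF g p(2,3)]] Cons.prems(2)
  show ?case by (simp add: p(1))
qed simp

end

section \<open>Products in a commutative algebra\<close>

context comm_assoc_algebra
begin

lemma mult_linear_right: "a \<in> carrier A \<Longrightarrow> linear_map K A A (\<lambda>b. a \<otimes>\<^bsub>A\<^esub> b)"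
  by (rule linear_mapI)
    (simp_all add: alg_mult_closed alg_mult_comm[of a] alg_distrib alg_smult_assoc)

lemma mult_linear_left: "b \<in> carrier A \<Longrightarrow> linear_map K A A (\<lambda>a. a \<otimes>\<^bsub>A\<^esub> b)"
  by (rule linear_mapI) (simp_all add: alg_mult_closed alg_distrib alg_smult_assoc)

lemma nonempty_prod_Cons: "as \<noteq> [] \<Longrightarrow> nonempty_prod A (a # as) = a \<otimes>\<^bsub>A\<^esub> nonempty_prod A as"
  by (cases as) auto

lemma nonempty_prod_closed:
  "\<lbrakk>as \<noteq> []; set as \<subseteq> carrier A\<rbrakk> \<Longrightarrow> nonempty_prod A as \<in> carrier A"
proof (induction as)
  case (Cons a as)
  then show ?case by (cases "as = []") (auto simp: nonempty_prod_Cons alg_mult_closed)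
qed simp

lemma nonempty_prod_linear:
  "\<lbrakk>set as \<subseteq> carrier A; i < length as\<rbrakk> \<Longrightarrow> linear_map K A A (\<lambda>a. nonempty_prod A (as[i := a]))"
proof (induction as arbitrary: i)
  case (Cons b as)
  show ?case
  proof (cases i)
    case 0
    then show ?thesis
      using Cons.prems
      by (cases "as = []")
        (auto simp: nonempty_prod_Cons linear_map_ident nonempty_prod_closed mult_linear_left)
  next
    case (Suc j)
    then have "as \<noteq> []" "linear_map K A A (\<lambda>a. nonempty_prod A (as[j := a]))" "b \<in> carrier A"
      using Cons by auto
    then show ?thesis
      using Suc linear_map_compose[OF _ mult_linear_right[of b]] by (simp add: nonempty_prod_Cons)
  qed
qed simp

lemma nonempty_prod_append:
  "\<lbrakk>as \<noteq> []; bs \<noteq> []; set as \<subseteq> carrier A; set bs \<subseteq> carrier A\<rbrakk> \<Longrightarrow>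
    nonempty_prod A (as @ bs) = nonempty_prod A as \<otimes>\<^bsub>A\<^esub> nonempty_prod A bs"
proof (induction as)
  case (Cons a as)
  then show ?case
    by (cases "as = []") (auto simp: nonempty_prod_Cons alg_mult_assoc nonempty_prod_closed)
qed simp

lemma nonempty_prod_commute:
  assumes "set (as @ bs) \<subseteq> carrier A"
  shows "nonempty_prod A (as @ bs) = nonempty_prod A (bs @ as)"
proof (cases "as = [] \<or> bs = []")
  case False
  then show ?thesis
    using assms by (simp add: nonempty_prod_append) (simp add: alg_mult_comm nonempty_prod_closed)
qed auto

text \<open>The form of associativity that nested brackets require: the first factor of an inner
  bracket is itself a product and appears as a single entry in the product of the outer one.\<close>

lemma nonempty_prod_nested:
  assumes "bs \<noteq> []" "set (as @ bs @ cs) \<subseteq> carrier A"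
  shows "nonempty_prod A (as @ nonempty_prod A bs # cs) = nonempty_prod A (as @ bs @ cs)"
proof -
  have closed: "nonempty_prod A bs \<in> carrier A" using assms by (simp add: nonempty_prod_closed)
  have *: "nonempty_prod A (nonempty_prod A bs # cs) = nonempty_prod A (bs @ cs)"
    using assms by (cases "cs = []") (simp_all add: nonempty_prod_Cons nonempty_prod_append)
  show ?thesis
  proof (cases "as = []")
    case False
    have "nonempty_prod A (as @ nonempty_prod A bs # cs) =
        nonempty_prod A as \<otimes>\<^bsub>A\<^esub> nonempty_prod A (nonempty_prod A bs # cs)"
      using False assms closed by (intro nonempty_prod_append) auto
    also have "\<dots> = nonempty_prod A (as @ bs @ cs)"
      unfolding * using False assms by (intro nonempty_prod_append[symmetric]) auto
    finally show ?thesis .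
  qed (simp add: *)
qed

end

text \<open>\<open>nonempty_prod_commute\<close> permits rotating a list, which brings the first
  entry of \<open>as\<close> to the front of \<open>bs\<close>; the tails then have equal multisets.
  Singletons are separated because the tail must be nonempty for its product to be split
  off.\<close>

lemma (in comm_assoc_algebra) nonempty_prod_mset_cong:
  "\<lbrakk>mset as = mset bs; set as \<subseteq> carrier A\<rbrakk> \<Longrightarrow> nonempty_prod A as = nonempty_prod A bs"
proof (induction as arbitrary: bs)
  case (Cons a as)
  then have "a \<in> set bs" by (metis list.set_intros(1) mset_eq_setD)
  then obtain bs1 bs2 where bs: "bs = bs1 @ a # bs2" by (meson split_list)
  have ms: "mset as = mset (bs2 @ bs1)" using Cons.prems(1) by (simp add: bs)
  have sub: "set bs \<subseteq> carrier A" using Cons.prems mset_eq_setD by metis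
  then have "nonempty_prod A bs = nonempty_prod A (a # bs2 @ bs1)"
    unfolding bs by (subst nonempty_prod_commute) auto
  also have "\<dots> = nonempty_prod A (a # as)"
  proof (cases "as = []")
    case False
    then have "bs2 @ bs1 \<noteq> []" using ms by (metis mset_zero_iff)
    then show ?thesis
      using Cons.IH[OF ms] Cons.prems False by (simp add: nonempty_prod_Cons)
  qed (use ms in simp)
  finally show ?case by simp
qed simp

section \<open>The grading of a tensor product\<close>

context graded_vector_space
begin

text \<open>The family of homogeneous components of \<open>v\<close>. The extensional product makes
  it unique as a function, but only its values on \<open>carrier \<Gamma>\<close> are
  meaningful.\<close>

definition homogeneous_part :: "'v \<Rightarrow> 'g \<Rightarrow> 'v"
  where "homogeneous_part v = (THE f. f \<in> (\<Pi>\<^sub>E \<gamma>\<in>carrier \<Gamma>. Vg \<gamma>) \<and>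
           finite {\<gamma> \<in> carrier \<Gamma>. f \<gamma> \<noteq> \<zero>\<^bsub>V\<^esub>} \<and>
           v = (\<Oplus>\<^bsub>V\<^esub>\<gamma>\<in>{\<gamma> \<in> carrier \<Gamma>. f \<gamma> \<noteq> \<zero>\<^bsub>V\<^esub>}. f \<gamma>))"

lemma component_closed: "\<lbrakk>\<gamma> \<in> carrier \<Gamma>; x \<in> Vg \<gamma>\<rbrakk> \<Longrightarrow> x \<in> carrier V"
  using submodule_carrier[OF component_submodule] .

lemma homogeneous_part:
  assumes "v \<in> carrier V"
  shows homogeneous_part_in: "\<gamma> \<in> carrier \<Gamma> \<Longrightarrow> homogeneous_part v \<gamma> \<in> Vg \<gamma>"
    and homogeneous_part_finite: "finite {\<gamma> \<in> carrier \<Gamma>. homogeneous_part v \<gamma> \<noteq> \<zero>\<^bsub>V\<^esub>}"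
    and homogeneous_part_sum:
      "v = (\<Oplus>\<^bsub>V\<^esub>\<gamma>\<in>{\<gamma> \<in> carrier \<Gamma>. homogeneous_part v \<gamma> \<noteq> \<zero>\<^bsub>V\<^esub>}. homogeneous_part v \<gamma>)"
  using theI'[OF unique_decomposition[OF assms], folded homogeneous_part_def]
  by (auto simp: PiE_iff)

lemma sum_over_support:
  assumes "\<And>\<gamma>. \<gamma> \<in> carrier \<Gamma> \<Longrightarrow> f \<gamma> \<in> carrier V"
    and "finite S" "S \<subseteq> carrier \<Gamma>" "\<And>\<gamma>. \<lbrakk>\<gamma> \<in> carrier \<Gamma>; \<gamma> \<notin> S\<rbrakk> \<Longrightarrow> f \<gamma> = \<zero>\<^bsub>V\<^esub>"
  shows "(\<Oplus>\<^bsub>V\<^esub>\<gamma>\<in>{\<gamma> \<in> carrier \<Gamma>. f \<gamma> \<noteq> \<zero>\<^bsub>V\<^esub>}. f \<gamma>) = (\<Oplus>\<^bsub>V\<^esub>\<gamma>\<in>S. f \<gamma>)"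
  using assms by (intro M.add.finprod_mono_neutral_cong_left) auto

text \<open>Neither extensionality of \<open>f\<close> nor the exact support is demanded, so that
  families obtained by adding or scaling decompositions qualify directly.\<close>

lemma homogeneous_part_unique:
  assumes f: "\<And>\<gamma>. \<gamma> \<in> carrier \<Gamma> \<Longrightarrow> f \<gamma> \<in> Vg \<gamma>"
    and S: "finite S" "S \<subseteq> carrier \<Gamma>" "\<And>\<gamma>. \<lbrakk>\<gamma> \<in> carrier \<Gamma>; \<gamma> \<notin> S\<rbrakk> \<Longrightarrow> f \<gamma> = \<zero>\<^bsub>V\<^esub>"
    and v: "v = (\<Oplus>\<^bsub>V\<^esub>\<gamma>\<in>S. f \<gamma>)" and \<gamma>: "\<gamma> \<in> carrier \<Gamma>"
  shows "homogeneous_part v \<gamma> = f \<gamma>"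
proof -
  \<comment> \<open>Uniqueness in the axiom concerns extensional families, hence the
    restriction.\<close>
  let ?f = "restrict f (carrier \<Gamma>)"
  have fV: "f \<gamma> \<in> carrier V" if "\<gamma> \<in> carrier \<Gamma>" for \<gamma> using component_closed f that by blast
  have vV: "v \<in> carrier V" unfolding v using fV S by (intro M.finsum_closed) auto
  have "{\<gamma> \<in> carrier \<Gamma>. ?f \<gamma> \<noteq> \<zero>\<^bsub>V\<^esub>} \<subseteq> S" using S by auto
  then have fin: "finite {\<gamma> \<in> carrier \<Gamma>. ?f \<gamma> \<noteq> \<zero>\<^bsub>V\<^esub>}" using S finite_subset by blast
  have "v = (\<Oplus>\<^bsub>V\<^esub>\<gamma>\<in>S. ?f \<gamma>)" unfolding v using fV S by (intro M.finsum_cong') auto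
  also have "\<dots> = (\<Oplus>\<^bsub>V\<^esub>\<gamma>\<in>{\<gamma> \<in> carrier \<Gamma>. ?f \<gamma> \<noteq> \<zero>\<^bsub>V\<^esub>}. ?f \<gamma>)"
    using fV S by (intro sum_over_support[symmetric]) auto
  finally have "?f \<in> (\<Pi>\<^sub>E \<gamma>\<in>carrier \<Gamma>. Vg \<gamma>) \<and> finite {\<gamma> \<in> carrier \<Gamma>. ?f \<gamma> \<noteq> \<zero>\<^bsub>V\<^esub>} \<and>
      v = (\<Oplus>\<^bsub>V\<^esub>\<gamma>\<in>{\<gamma> \<in> carrier \<Gamma>. ?f \<gamma> \<noteq> \<zero>\<^bsub>V\<^esub>}. ?f \<gamma>)"
    using fin f by auto
  then have "homogeneous_part v = ?f"
    unfolding homogeneous_part_def by (intro the1_equality[OF unique_decomposition[OF vV]])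
  then show ?thesis using \<gamma> by simp
qed

text \<open>Adding or scaling decompositions termwise gives a decomposition of the sum or multiple,
  and uniqueness identifies it with the family of components.\<close>

lemma homogeneous_part_linear:
  assumes \<gamma>: "\<gamma> \<in> carrier \<Gamma>"
  shows "linear_map K V V (\<lambda>v. homogeneous_part v \<gamma>)"
proof (rule linear_mapI)
  show "homogeneous_part v \<gamma> \<in> carrier V" if "v \<in> carrier V" for v
    using component_closed homogeneous_part_in that \<gamma> by blast
next
  fix v w assume v: "v \<in> carrier V" and w: "w \<in> carrier V"
  let ?p = homogeneous_part
  let ?S = "{\<gamma> \<in> carrier \<Gamma>. ?p v \<gamma> \<noteq> \<zero>\<^bsub>V\<^esub>} \<union> {\<gamma> \<in> carrier \<Gamma>. ?p w \<gamma> \<noteq> \<zero>\<^bsub>V\<^esub>}"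
  have S: "finite ?S" "?S \<subseteq> carrier \<Gamma>" using homogeneous_part_finite v w by auto
  have pV: "?p u \<gamma> \<in> carrier V" if "u \<in> carrier V" "\<gamma> \<in> carrier \<Gamma>" for u \<gamma>
    using component_closed homogeneous_part_in that by blast
  have "v = (\<Oplus>\<^bsub>V\<^esub>\<gamma>\<in>?S. ?p v \<gamma>)"
    by (subst sum_over_support[of "?p v" ?S, symmetric])
      (use S pV v homogeneous_part_sum[OF v] in auto)
  moreover have "w = (\<Oplus>\<^bsub>V\<^esub>\<gamma>\<in>?S. ?p w \<gamma>)"
    by (subst sum_over_support[of "?p w" ?S, symmetric])
      (use S pV w homogeneous_part_sum[OF w] in auto)
  moreover have "(\<Oplus>\<^bsub>V\<^esub>\<gamma>\<in>?S. ?p v \<gamma> \<oplus>\<^bsub>V\<^esub> ?p w \<gamma>) =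
      (\<Oplus>\<^bsub>V\<^esub>\<gamma>\<in>?S. ?p v \<gamma>) \<oplus>\<^bsub>V\<^esub> (\<Oplus>\<^bsub>V\<^esub>\<gamma>\<in>?S. ?p w \<gamma>)"
    using pV v w by (intro M.finsum_addf) auto
  ultimately have sum: "v \<oplus>\<^bsub>V\<^esub> w = (\<Oplus>\<^bsub>V\<^esub>\<gamma>\<in>?S. ?p v \<gamma> \<oplus>\<^bsub>V\<^esub> ?p w \<gamma>)" by simp
  show "?p (v \<oplus>\<^bsub>V\<^esub> w) \<gamma> = ?p v \<gamma> \<oplus>\<^bsub>V\<^esub> ?p w \<gamma>"
    using v w
    by (intro homogeneous_part_unique[OF _ S _ sum \<gamma>] submodule_add[OF component_submodule]
        homogeneous_part_in) auto
next
  fix c v assume c: "c \<in> carrier K" and v: "v \<in> carrier V"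
  let ?p = homogeneous_part
  let ?S = "{\<gamma> \<in> carrier \<Gamma>. ?p v \<gamma> \<noteq> \<zero>\<^bsub>V\<^esub>}"
  have S: "finite ?S" "?S \<subseteq> carrier \<Gamma>" using homogeneous_part_finite v by auto
  have pV: "?p v \<gamma> \<in> carrier V" if "\<gamma> \<in> carrier \<Gamma>" for \<gamma>
    using component_closed homogeneous_part_in[OF v] that by blast
  have "(\<Oplus>\<^bsub>V\<^esub>\<gamma>\<in>?S. c \<odot>\<^bsub>V\<^esub> ?p v \<gamma>) = c \<odot>\<^bsub>V\<^esub> (\<Oplus>\<^bsub>V\<^esub>\<gamma>\<in>?S. ?p v \<gamma>)"
    using c S pV by (intro finsum_smult_ldistr[symmetric]) auto
  then have sum: "c \<odot>\<^bsub>V\<^esub> v = (\<Oplus>\<^bsub>V\<^esub>\<gamma>\<in>?S. c \<odot>\<^bsub>V\<^esub> ?p v \<gamma>)"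
    using homogeneous_part_sum[OF v] by simp
  show "?p (c \<odot>\<^bsub>V\<^esub> v) \<gamma> = c \<odot>\<^bsub>V\<^esub> ?p v \<gamma>"
    using c v
    by (intro homogeneous_part_unique[OF _ S _ sum \<gamma>] submodule.smult_closed[OF component_submodule]
        homogeneous_part_in) auto
qed

lemma homogeneous_part_homogeneous:
  assumes "\<gamma> \<in> carrier \<Gamma>" "\<delta> \<in> carrier \<Gamma>" "x \<in> Vg \<delta>"
  shows "homogeneous_part x \<gamma> = (if \<gamma> = \<delta> then x else \<zero>\<^bsub>V\<^esub>)"
proof (rule homogeneous_part_unique[where S = "{\<delta>}"])
  show "x = (\<Oplus>\<^bsub>V\<^esub>\<gamma>\<in>{\<delta>}. if \<gamma> = \<delta> then x else \<zero>\<^bsub>V\<^esub>)"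
    using component_closed[OF assms(2,3)] by simp
qed (use assms submodule_zero[OF component_submodule] in auto)

end

locale graded_tensor_product =
  M: module K M + N: graded_vector_space K \<Gamma> N Ng
  for K :: "('k, 'm) ring_scheme" and \<Gamma> :: "('g, 'l) monoid_scheme"
    and M :: "('k, 'a, 'p) module_scheme"
    and N :: "('k, 'v, 'q) module_scheme" and Ng :: "'g \<Rightarrow> 'v set"
begin

sublocale tensor_product K M N by unfold_locales

lemma tensor_grading_eq:
  "\<gamma> \<in> carrier \<Gamma> \<Longrightarrow> tensor_grading K M N Ng \<gamma> = tensor_sums K M N (Ng \<gamma>)"
  unfolding tensor_grading_def by (rule generated_submodule_pure[OF N.component_submodule])

lemma tensor_component_submodule:
  "\<gamma> \<in> carrier \<Gamma> \<Longrightarrow> submodule (tensor_sums K M N (Ng \<gamma>)) K T"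
  by (rule tensor_sums_submodule[OF N.component_submodule])

lemma tensor_component_closed:
  "\<lbrakk>\<gamma> \<in> carrier \<Gamma>; t \<in> tensor_sums K M N (Ng \<gamma>)\<rbrakk> \<Longrightarrow> t \<in> carrier T"
  by (rule submodule_carrier[OF tensor_component_submodule])

definition part :: "'g \<Rightarrow> ('a \<times> 'v \<Rightarrow> 'k) set \<Rightarrow> ('a \<times> 'v \<Rightarrow> 'k) set"
  where "part \<gamma> = tensor_lift K T (\<lambda>a x. a \<otimes>\<otimes> N.homogeneous_part x \<gamma>)"

lemma
  assumes \<gamma>: "\<gamma> \<in> carrier \<Gamma>"
  shows part_linear: "linear_map K T T (part \<gamma>)"
    and part_pure:
      "\<lbrakk>a \<in> carrier M; x \<in> carrier N\<rbrakk> \<Longrightarrow> part \<gamma> (a \<otimes>\<otimes> x) = a \<otimes>\<otimes> N.homogeneous_part x \<gamma>"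
proof -
  note lin = N.homogeneous_part_linear[OF \<gamma>]
  have bil: "bilinear_map K M N T (\<lambda>a x. a \<otimes>\<otimes> N.homogeneous_part x \<gamma>)"
    unfolding bilinear_map_def
    using linear_map_compose[OF lin pure_linear_right] pure_linear_left linear_map_closed[OF lin]
    by blast
  show "linear_map K T T (part \<gamma>)"
    unfolding part_def by (rule tensor_lift_linear[OF T.module_axioms bil])
  show "\<lbrakk>a \<in> carrier M; x \<in> carrier N\<rbrakk> \<Longrightarrow> part \<gamma> (a \<otimes>\<otimes> x) = a \<otimes>\<otimes> N.homogeneous_part x \<gamma>"
    unfolding part_def by (rule tensor_lift_pure[OF T.module_axioms bil])
qed

lemma part_homogeneous:
  assumes \<gamma>: "\<gamma> \<in> carrier \<Gamma>" and \<delta>: "\<delta> \<in> carrier \<Gamma>" and t: "t \<in> tensor_sums K M N (Ng \<delta>)"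
  shows "part \<gamma> t = (if \<gamma> = \<delta> then t else \<zero>\<^bsub>T\<^esub>)"
  using t
proof induction
  case (pure a x)
  then show ?case
    using part_pure[OF \<gamma>, of a x] N.component_closed[OF \<delta>] N.homogeneous_part_homogeneous[OF \<gamma> \<delta>]
      linear_map_zero[OF N.module_axioms T.module_axioms pure_linear_right] by simp
next
  case (add s t)
  then show ?case
    using linear_map_add[OF part_linear[OF \<gamma>], of s t] tensor_component_closed[OF \<delta>] by simp
qed

text \<open>The index set \<open>S\<close> may exceed the support. Thus two decompositions can be
  added over the union of their index sets even when some terms cancel.\<close>

lemma decomposition_exists:
  assumes "t \<in> carrier T"
  shows "\<exists>f S. (\<forall>\<gamma>\<in>carrier \<Gamma>. f \<gamma> \<in> tensor_sums K M N (Ng \<gamma>)) \<and> finite S \<and> S \<subseteq> carrier \<Gamma> \<and>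
    (\<forall>\<gamma>\<in>carrier \<Gamma> - S. f \<gamma> = \<zero>\<^bsub>T\<^esub>) \<and> t = (\<Oplus>\<^bsub>T\<^esub>\<gamma>\<in>S. f \<gamma>)"
  using assms unfolding carrier_eq_tensor_sums
proof induction
  case (pure a x)
  let ?S = "{\<gamma> \<in> carrier \<Gamma>. N.homogeneous_part x \<gamma> \<noteq> \<zero>\<^bsub>N\<^esub>}"
  note zero = linear_map_zero[OF N.module_axioms T.module_axioms pure_linear_right]
  have fin: "finite ?S" using N.homogeneous_part_finite pure by blast
  have "N.homogeneous_part x \<in> ?S \<rightarrow> carrier N"
    using N.component_closed N.homogeneous_part_in pure by auto
  then have "a \<otimes>\<otimes> x = (\<Oplus>\<^bsub>T\<^esub>\<gamma>\<in>?S. a \<otimes>\<otimes> N.homogeneous_part x \<gamma>)"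
    by (rule trans[OF arg_cong[where f = "(\<otimes>\<otimes>) a", OF N.homogeneous_part_sum[OF pure(2)]]
          linear_map_finsum[OF N.module_axioms T.module_axioms pure_linear_right[OF pure(1)] fin]])
  then show ?case
    using fin pure zero[OF pure(1)]
    by (intro exI[of _ "\<lambda>\<gamma>. a \<otimes>\<otimes> N.homogeneous_part x \<gamma>"] exI[of _ ?S])
      (auto intro: tensor_sums.pure N.homogeneous_part_in)
next
  case (add s t)
  obtain f S where f: "\<forall>\<gamma>\<in>carrier \<Gamma>. f \<gamma> \<in> tensor_sums K M N (Ng \<gamma>)" "finite S" "S \<subseteq> carrier \<Gamma>"
    "\<forall>\<gamma>\<in>carrier \<Gamma> - S. f \<gamma> = \<zero>\<^bsub>T\<^esub>" "s = (\<Oplus>\<^bsub>T\<^esub>\<gamma>\<in>S. f \<gamma>)" using add by blast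
  obtain g R where g: "\<forall>\<gamma>\<in>carrier \<Gamma>. g \<gamma> \<in> tensor_sums K M N (Ng \<gamma>)" "finite R" "R \<subseteq> carrier \<Gamma>"
    "\<forall>\<gamma>\<in>carrier \<Gamma> - R. g \<gamma> = \<zero>\<^bsub>T\<^esub>" "t = (\<Oplus>\<^bsub>T\<^esub>\<gamma>\<in>R. g \<gamma>)" using add by blast
  have fT: "f \<gamma> \<in> carrier T" "g \<gamma> \<in> carrier T" if "\<gamma> \<in> carrier \<Gamma>" for \<gamma>
    using f g that tensor_component_closed by blast+
  have "s = (\<Oplus>\<^bsub>T\<^esub>\<gamma>\<in>S \<union> R. f \<gamma>)"
    unfolding f(5) using f g fT by (intro T.M.add.finprod_mono_neutral_cong_left) auto
  moreover have "t = (\<Oplus>\<^bsub>T\<^esub>\<gamma>\<in>S \<union> R. g \<gamma>)"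
    unfolding g(5) using f g fT by (intro T.M.add.finprod_mono_neutral_cong_left) auto
  moreover have "(\<Oplus>\<^bsub>T\<^esub>\<gamma>\<in>S \<union> R. f \<gamma> \<oplus>\<^bsub>T\<^esub> g \<gamma>) =
      (\<Oplus>\<^bsub>T\<^esub>\<gamma>\<in>S \<union> R. f \<gamma>) \<oplus>\<^bsub>T\<^esub> (\<Oplus>\<^bsub>T\<^esub>\<gamma>\<in>S \<union> R. g \<gamma>)"
    using f g fT by (intro T.M.finsum_addf) auto
  ultimately show ?case
    using f g fT
    by (intro exI[of _ "\<lambda>\<gamma>. f \<gamma> \<oplus>\<^bsub>T\<^esub> g \<gamma>"] exI[of _ "S \<union> R"])
      (auto intro: tensor_sums.add)
qed

lemma graded_vector_space_tensor:
  "graded_vector_space K \<Gamma> T (tensor_grading K M N Ng)"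
proof (intro graded_vector_space.intro graded_vector_space_axioms.intro T.module_axioms)
  show "field K" by (rule N.field_axioms)
  show "comm_group \<Gamma>" by (rule N.comm_group_axioms)
  show "submodule (tensor_grading K M N Ng \<gamma>) K T" if "\<gamma> \<in> carrier \<Gamma>" for \<gamma>
    using tensor_component_submodule[OF that] tensor_grading_eq[OF that] by simp
  fix t assume t: "t \<in> carrier T"
  let ?dec = "\<lambda>f. f \<in> (\<Pi>\<^sub>E \<gamma>\<in>carrier \<Gamma>. tensor_grading K M N Ng \<gamma>) \<and>
      finite {\<gamma> \<in> carrier \<Gamma>. f \<gamma> \<noteq> \<zero>\<^bsub>T\<^esub>} \<and> t = (\<Oplus>\<^bsub>T\<^esub>\<gamma>\<in>{\<gamma> \<in> carrier \<Gamma>. f \<gamma> \<noteq> \<zero>\<^bsub>T\<^esub>}. f \<gamma>)"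
  obtain f S where f: "\<forall>\<gamma>\<in>carrier \<Gamma>. f \<gamma> \<in> tensor_sums K M N (Ng \<gamma>)" "finite S" "S \<subseteq> carrier \<Gamma>"
    "\<forall>\<gamma>\<in>carrier \<Gamma> - S. f \<gamma> = \<zero>\<^bsub>T\<^esub>" "t = (\<Oplus>\<^bsub>T\<^esub>\<gamma>\<in>S. f \<gamma>)"
    using decomposition_exists[OF t] by blast
  let ?f = "restrict f (carrier \<Gamma>)"
  have fT: "f \<gamma> \<in> carrier T" if "\<gamma> \<in> carrier \<Gamma>" for \<gamma>
    using f that tensor_component_closed by blast
  have supp: "{\<gamma> \<in> carrier \<Gamma>. ?f \<gamma> \<noteq> \<zero>\<^bsub>T\<^esub>} \<subseteq> S" using f(4) by auto
  have "(\<Oplus>\<^bsub>T\<^esub>\<gamma>\<in>{\<gamma> \<in> carrier \<Gamma>. ?f \<gamma> \<noteq> \<zero>\<^bsub>T\<^esub>}. ?f \<gamma>) = (\<Oplus>\<^bsub>T\<^esub>\<gamma>\<in>S. f \<gamma>)"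
    using f fT by (intro T.M.add.finprod_mono_neutral_cong_left) auto
  then have "?dec ?f"
    using f finite_subset[OF supp] by (auto simp: tensor_grading_eq)
  moreover have "h = h'" if h: "?dec h" and h': "?dec h'" for h h'
  proof -
    have *: "h \<gamma> = part \<gamma> t" if \<gamma>: "\<gamma> \<in> carrier \<Gamma>" and h: "?dec h" for h \<gamma>
    proof -
      let ?S = "{\<gamma> \<in> carrier \<Gamma>. h \<gamma> \<noteq> \<zero>\<^bsub>T\<^esub>}"
      have hs: "h \<delta> \<in> tensor_sums K M N (Ng \<delta>)" if "\<delta> \<in> carrier \<Gamma>" for \<delta>
        using h that tensor_grading_eq[OF that] by auto
      have hT: "h \<delta> \<in> carrier T" if "\<delta> \<in> carrier \<Gamma>" for \<delta>
        using hs tensor_component_closed that by blast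
      have t_sum: "t = (\<Oplus>\<^bsub>T\<^esub>\<delta>\<in>?S. h \<delta>)" using h by blast
      have "part \<gamma> t = (\<Oplus>\<^bsub>T\<^esub>\<delta>\<in>?S. part \<gamma> (h \<delta>))"
        unfolding t_sum
        using h hT by (intro linear_map_finsum[OF T.module_axioms T.module_axioms part_linear[OF \<gamma>]]) auto
      \<comment> \<open>Neither index set need contain the other: if \<gamma> lies outside the
        support, then \<open>h \<gamma>\<close> is zero and both sums vanish.\<close>
      also have "\<dots> = (\<Oplus>\<^bsub>T\<^esub>\<delta>\<in>{\<gamma>}. h \<delta>)"
        using h hT \<gamma> part_homogeneous[OF \<gamma> _ hs] linear_map_closed[OF part_linear[OF \<gamma>]]
        by (intro T.M.add.finprod_mono_neutral_cong) auto
      also have "\<dots> = h \<gamma>" using hT[OF \<gamma>] by simp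
      finally show ?thesis by simp
    qed
    have "h \<in> extensional (carrier \<Gamma>)" "h' \<in> extensional (carrier \<Gamma>)" using h h' by (auto simp: PiE_iff)
    then show ?thesis using *[OF _ h] *[OF _ h'] by (intro extensionalityI) auto
  qed
  ultimately show "\<exists>!f. ?dec f" by blast
qed

end

section \<open>Identities on tensor products\<close>

lemma linear_map_finsum_fun:
  assumes "module K V" "module K W" "finite I" "\<And>i. i \<in> I \<Longrightarrow> linear_map K V W (f i)"
  shows "linear_map K V W (\<lambda>x. \<Oplus>\<^bsub>W\<^esub>i\<in>I. f i x)"
  using assms(3,4)
proof (induction I)
  interpret W: module K W by fact
  case empty
  show ?case by (rule linear_mapI) simp_all
next
  interpret V: module K V by fact
  interpret W: module K W by fact
  case (insert i I)
  have "linear_map K V W (\<lambda>x. f i x \<oplus>\<^bsub>W\<^esub> (\<Oplus>\<^bsub>W\<^esub>i\<in>I. f i x))"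
    using insert by (intro linear_map_sum assms(1,2) insert.IH) auto
  moreover have "(\<Oplus>\<^bsub>W\<^esub>i\<in>insert i I. f i x) = f i x \<oplus>\<^bsub>W\<^esub> (\<Oplus>\<^bsub>W\<^esub>i\<in>I. f i x)" if "x \<in> carrier V" for x
    using insert.hyps linear_map_closed[OF insert.prems that] by (intro W.finsum_insert) auto
  ultimately show ?case using linear_map_cong[OF assms(1)] by (metis (no_types, lifting))
qed

lemma linear_map_uminus:
  assumes "module K V"
  shows "linear_map K V V (\<lambda>x. \<ominus>\<^bsub>V\<^esub> x)"
proof -
  interpret V: module K V by fact
  show ?thesis by (rule linear_mapI) (simp_all add: V.M.minus_add V.smult_r_minus)
qed

text \<open>By induction on the set of slots whose entry is not a pure tensor.\<close>

lemma slotwise_induct: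
  assumes "finite I" and x: "\<And>i. i \<in> I \<Longrightarrow> x i \<in> tensor_sums K M N (X i)"
    and pure: "\<And>x. (\<And>i. i \<in> I \<Longrightarrow> \<exists>a\<in>carrier M. \<exists>y\<in>X i. x i = tensor_elem K M N a y) \<Longrightarrow> P x"
    and add: "\<And>x i s t. \<lbrakk>i \<in> I; \<And>j. j \<in> I \<Longrightarrow> x j \<in> tensor_sums K M N (X j);
        s \<in> tensor_sums K M N (X i); t \<in> tensor_sums K M N (X i); P (x(i := s)); P (x(i := t))\<rbrakk> \<Longrightarrow>
        P (x(i := s \<oplus>\<^bsub>tensor_module K M N\<^esub> t))"
  shows "P x"
proof -
  have "P x" if "J \<subseteq> I" "\<And>i. i \<in> I \<Longrightarrow> x i \<in> tensor_sums K M N (X i)"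
    "\<And>i. i \<in> I - J \<Longrightarrow> \<exists>a\<in>carrier M. \<exists>y\<in>X i. x i = tensor_elem K M N a y" for J x
    using finite_subset[OF that(1) \<open>finite I\<close>] that
  proof (induction J arbitrary: x rule: finite_induct)
    case empty
    then show ?case by (intro pure) auto
  next
    case (insert j J)
    have j: "j \<in> I" using insert by auto
    \<comment> \<open>Slot \<open>j\<close> is filled with an arbitrary \<open>t\<close>, built up
      from pure tensors by an inner induction. When \<open>t\<close> is pure, \<open>j\<close> no
      longer counts as an impure slot and the outer hypothesis for \<open>J\<close> applies.\<close>
    have "P (x(j := t))" if "t \<in> tensor_sums K M N (X j)" for t
      using that
    proof induction
      case (pure a y)
      then show ?case
        using insert.prems
        by (intro insert.IH) (auto intro: tensor_sums.pure)
    next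
      case (add s t)
      then show ?case using j insert.prems(2) by (blast intro: assms(4))
    qed
    from this[of "x j"] insert.prems(2)[OF j] show ?case by simp
  qed
  from this[of I x] x show ?thesis by simp
qed

text \<open>Arguments are numbered from 1 and list positions from 0, hence
  \<open>k - 1\<close>.\<close>

lemma map_upt_update:
  assumes "k \<in> {1..n}"
  shows "map (h(k := s)) [1..<Suc n] = (map h [1..<Suc n])[k - 1 := s]"
  using assms by (intro nth_equalityI) (auto simp: nth_list_update simp del: upt_Suc)

lemma upt_split_Suc: "k \<in> {1..n} \<Longrightarrow> [1..<Suc n] = [1..<k] @ k # [Suc k..<Suc n]"
  using upt_add_eq_append[of 1 k "Suc n - k"] upt_conv_Cons[of k "Suc n"] by auto

lemma upt_snoc: "1 \<le> n \<Longrightarrow> [1..<Suc n] = [1..<n] @ [n]"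
  by simp

text \<open>With one map over all slots, the twisted argument list becomes an ordinary family whose
  entries can be updated uniformly, including the last.\<close>

lemma bihom_args_eq:
  "1 \<le> n \<Longrightarrow> bihom_args n \<alpha> \<beta> x = map (\<lambda>i. if i = n then \<alpha> (x i) else \<beta> (x i)) [1..<Suc n]"
  unfolding bihom_args_def by (subst upt_snoc) auto

section \<open>Existence of the operations on A \<otimes> L\<close>

locale tensor_color_algebra =
  comm_assoc_algebra K A + L: n_BiHom_Lie_color_algebra K \<Gamma> n L Lg br \<epsilon> \<alpha> \<beta>
  for K :: "('k, 'm) ring_scheme" and \<Gamma> :: "('g, 'l) monoid_scheme" and n :: nat
    and A :: "('k, 'a, 'p) module_scheme"
    and L :: "('k, 'v, 'q) module_scheme" and Lg :: "'g \<Rightarrow> 'v set"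
    and br :: "'v list \<Rightarrow> 'v" and \<epsilon> :: "'g \<Rightarrow> 'g \<Rightarrow> 'k" and \<alpha> \<beta> :: "'v \<Rightarrow> 'v"
begin

sublocale graded_tensor_product K \<Gamma> A L Lg by unfold_locales

notation pure (infix "\<otimes>\<otimes>" 75)

lemma bracket_closed: "\<lbrakk>length xs = n; set xs \<subseteq> carrier L\<rbrakk> \<Longrightarrow> br xs \<in> carrier L"
  using L.bracket_multilinear by (simp add: multilinear_map_def)

lemma bracket_linear:
  "\<lbrakk>length xs = n; set xs \<subseteq> carrier L; i < n\<rbrakk> \<Longrightarrow> linear_map K L L (\<lambda>x. br (xs[i := x]))"
  using L.bracket_multilinear by (simp add: multilinear_map_def)

text \<open>Replacing one pair changes one factor of the product and one argument of the bracket;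
  each depends linearly on its entry, and the pure tensor is bilinear in the two results.\<close>

lemma tensor_bracket_multibilinear:
  "multibilinear K A L T n (\<lambda>ps. nonempty_prod A (map fst ps) \<otimes>\<otimes> br (map snd ps))"
  unfolding multibilinear_def
proof (intro allI impI conjI)
  fix ps assume ps: "length ps = n \<and> set ps \<subseteq> carrier A \<times> carrier L"
  have as: "set (map fst ps) \<subseteq> carrier A" and xs: "set (map snd ps) \<subseteq> carrier L"
    and ne: "ps \<noteq> []" using ps L.arity by auto
  show "nonempty_prod A (map fst ps) \<otimes>\<otimes> br (map snd ps) \<in> carrier T"
    using as xs ne ps by (intro pure_closed nonempty_prod_closed bracket_closed) auto
  fix i assume i: "i < n"
  have prod: "linear_map K A A (\<lambda>a. nonempty_prod A ((map fst ps)[i := a]))"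
    using i ps as by (intro nonempty_prod_linear) auto
  have brk: "linear_map K L L (\<lambda>x. br ((map snd ps)[i := x]))"
    using i ps xs by (intro bracket_linear) auto
  show "bilinear_map K A L T
      (\<lambda>a x. nonempty_prod A (map fst (ps[i := (a, x)])) \<otimes>\<otimes> br (map snd (ps[i := (a, x)])))"
    unfolding bilinear_map_def map_update fst_conv snd_conv
    using linear_map_compose[OF prod pure_linear_left] linear_map_compose[OF brk pure_linear_right]
      linear_map_closed[OF prod] linear_map_closed[OF brk] by blast
qed

lemma bilinear_pure_compose:
  assumes "linear_map K L L f"
  shows "bilinear_map K A L T (\<lambda>a x. a \<otimes>\<otimes> f x)"
  unfolding bilinear_map_def
  using linear_map_compose[OF assms pure_linear_right] pure_linear_left linear_map_closed[OF assms]
  by blast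

lemma tensor_operations_exist:
  "\<exists>br' \<alpha>' \<beta>'. tensor_operations K A n L br \<alpha> \<beta> br' \<alpha>' \<beta>'"
proof -
  let ?g = "\<lambda>ps. nonempty_prod A (map fst ps) \<otimes>\<otimes> br (map snd ps)"
  let ?lift = "\<lambda>f. tensor_lift K T (\<lambda>a x. a \<otimes>\<otimes> f x)"
  note T = T.module_axioms and g = tensor_bracket_multibilinear
  have "multilinear_map K T n (multi_lift K T ?g)"
    unfolding multilinear_map_def
    using multi_lift_closed[OF T _] multi_lift_linear[OF T] g by blast
  moreover have "multi_lift K T ?g (map2 (\<otimes>\<otimes>) as xs) = nonempty_prod A as \<otimes>\<otimes> br xs"
    if "length as = n" "set as \<subseteq> carrier A" "length xs = n" "set xs \<subseteq> carrier L" for as xs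
  proof -
    have "multibilinear K A L T (length (zip as xs)) ?g" using g that by simp
    moreover have "set (zip as xs) \<subseteq> carrier A \<times> carrier L"
      using that by (auto dest: set_zip_leftD set_zip_rightD)
    ultimately show ?thesis using multi_lift_pure[OF T] that by simp
  qed
  ultimately have "tensor_operations K A n L br \<alpha> \<beta> (multi_lift K T ?g) (?lift \<alpha>) (?lift \<beta>)"
    unfolding tensor_operations_def
    using tensor_lift_linear[OF T bilinear_pure_compose] tensor_lift_pure[OF T bilinear_pure_compose]
      L.alpha_linear L.beta_linear by simp
  then show ?thesis by blast
qed

end

text \<open>The operations are arbitrary maps with the prescribed values, not the lifts constructed
  above, so what follows applies to every such choice.\<close>

locale tensor_color_operations = tensor_color_algebra +
  fixes br' and \<alpha>' and \<beta>'
  assumes operations: "tensor_operations K A n L br \<alpha> \<beta> br' \<alpha>' \<beta>'"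
begin

section \<open>Multilinearity and values on pure tensors of the brackets\<close>

lemma
  shows br'_multilinear: "multilinear_map K T n br'"
    and br'_pure: "\<lbrakk>length as = n; set as \<subseteq> carrier A; length xs = n; set xs \<subseteq> carrier L\<rbrakk> \<Longrightarrow>
      br' (map2 (\<otimes>\<otimes>) as xs) = nonempty_prod A as \<otimes>\<otimes> br xs"
    and alpha'_linear: "linear_map K T T \<alpha>'"
    and alpha'_pure: "\<lbrakk>a \<in> carrier A; x \<in> carrier L\<rbrakk> \<Longrightarrow> \<alpha>' (a \<otimes>\<otimes> x) = a \<otimes>\<otimes> \<alpha> x"
    and beta'_linear: "linear_map K T T \<beta>'"
    and beta'_pure: "\<lbrakk>a \<in> carrier A; x \<in> carrier L\<rbrakk> \<Longrightarrow> \<beta>' (a \<otimes>\<otimes> x) = a \<otimes>\<otimes> \<beta> x"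
  using operations by (auto simp: tensor_operations_def)

text \<open>Brackets are taken of families indexed by 1, ..., n instead of lists: changing one
  argument is then a function update, and linearity in a slot can be stated with it.\<close>

abbreviation "Tg \<gamma> \<equiv> tensor_sums K A L (Lg \<gamma>)"
abbreviation "B x \<equiv> br' (map x [1..<Suc n])"
abbreviation "C x \<equiv> br' (bihom_args n \<alpha>' \<beta>' x)"

lemma B_closed: "(\<And>i. i \<in> {1..n} \<Longrightarrow> x i \<in> carrier T) \<Longrightarrow> B x \<in> carrier T"
  using br'_multilinear[unfolded multilinear_map_def, rule_format, of "map x [1..<Suc n]"]
  by (simp add: image_subset_iff del: upt_Suc)

lemma B_linear:
  assumes k: "k \<in> {1..n}" and x: "\<And>i. i \<in> {1..n} - {k} \<Longrightarrow> x i \<in> carrier T"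
  shows "linear_map K T T (\<lambda>s. B (x(k := s)))"
proof -
  \<comment> \<open>The entry at \<open>k\<close> is unconstrained, while
    \<open>multilinear_map\<close> speaks of lists within the carrier; zero serves as a placeholder
    that the update overwrites.\<close>
  let ?x = "x(k := \<zero>\<^bsub>T\<^esub>)"
  have "length (map ?x [1..<Suc n]) = n" "set (map ?x [1..<Suc n]) \<subseteq> carrier T" "k - 1 < n"
    using x k by (auto simp del: upt_Suc)
  then have "linear_map K T T (\<lambda>s. br' ((map ?x [1..<Suc n])[k - 1 := s]))"
    using br'_multilinear unfolding multilinear_map_def by blast
  then show ?thesis unfolding map_upt_update[OF k, symmetric] by simp
qed

abbreviation "tw x i \<equiv> (if i = n then \<alpha>' (x i) else \<beta>' (x i))"

lemma C_eq: "C x = B (tw x)"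
  using L.arity by (simp add: bihom_args_eq del: upt_Suc)

lemma C_closed: "(\<And>i. i \<in> {1..n} \<Longrightarrow> x i \<in> carrier T) \<Longrightarrow> C x \<in> carrier T"
  unfolding C_eq by (rule B_closed) (auto intro: linear_map_closed[OF alpha'_linear] linear_map_closed[OF beta'_linear])

lemma C_linear:
  assumes k: "k \<in> {1..n}" and x: "\<And>i. i \<in> {1..n} - {k} \<Longrightarrow> x i \<in> carrier T"
  shows "linear_map K T T (\<lambda>s. C (x(k := s)))"
proof -
  have "linear_map K T T (\<lambda>s. if k = n then \<alpha>' s else \<beta>' s)"
    using alpha'_linear beta'_linear by (cases "k = n") simp_all
  moreover have "linear_map K T T (\<lambda>s. B ((\<lambda>i. tw x i)(k := s)))"
    using x by (intro B_linear k)
      (auto intro: linear_map_closed[OF alpha'_linear] linear_map_closed[OF beta'_linear])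
  ultimately have "linear_map K T T (\<lambda>s. B ((\<lambda>i. tw x i)(k := (if k = n then \<alpha>' s else \<beta>' s))))"
    by (rule linear_map_compose)
  moreover have "(\<lambda>i. tw (x(k := s)) i) = (\<lambda>i. tw x i)(k := (if k = n then \<alpha>' s else \<beta>' s))" for s
    by (auto simp: fun_eq_iff)
  ultimately show ?thesis unfolding C_eq by simp
qed

lemma map_pure: "map (\<lambda>i. a i \<otimes>\<otimes> x i) is = map2 (\<otimes>\<otimes>) (map a is) (map x is)"
  by (induction "is") auto

lemma B_pure:
  assumes "\<And>i. i \<in> {1..n} \<Longrightarrow> a i \<in> carrier A \<and> y i \<in> carrier L \<and> x i = a i \<otimes>\<otimes> y i"
  shows "B x = nonempty_prod A (map a [1..<Suc n]) \<otimes>\<otimes> br (map y [1..<Suc n])"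
proof -
  have "map x [1..<Suc n] = map2 (\<otimes>\<otimes>) (map a [1..<Suc n]) (map y [1..<Suc n])"
    unfolding map_pure[symmetric] using assms by (auto simp del: upt_Suc)
  then show ?thesis using assms by (simp del: upt_Suc add: br'_pure image_subset_iff)
qed

lemma C_pure:
  assumes "\<And>i. i \<in> {1..n} \<Longrightarrow> a i \<in> carrier A \<and> y i \<in> carrier L \<and> x i = a i \<otimes>\<otimes> y i"
  shows "C x = nonempty_prod A (map a [1..<Suc n]) \<otimes>\<otimes> br (bihom_args n \<alpha> \<beta> y)"
proof -
  have "C x = nonempty_prod A (map a [1..<Suc n]) \<otimes>\<otimes>
      br (map (\<lambda>i. if i = n then \<alpha> (y i) else \<beta> (y i)) [1..<Suc n])"
    unfolding C_eq
    by (rule B_pure) (auto simp: assms alpha'_pure beta'_pure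
        intro: linear_map_closed[OF L.alpha_linear] linear_map_closed[OF L.beta_linear])
  then show ?thesis using L.arity by (simp add: bihom_args_eq del: upt_Suc)
qed

lemma prod_closed:
  "(\<And>i. i \<in> {1..n} \<Longrightarrow> a i \<in> carrier A) \<Longrightarrow> nonempty_prod A (map a [1..<Suc n]) \<in> carrier A"
  using L.arity by (intro nonempty_prod_closed) (auto simp del: upt_Suc)

lemma bihom_bracket_closed:
  assumes "\<And>i. i \<in> {1..n} \<Longrightarrow> y i \<in> carrier L"
  shows "br (bihom_args n \<alpha> \<beta> y) \<in> carrier L"
  using L.arity assms
  by (intro bracket_closed) (auto simp: bihom_args_def
      intro!: linear_map_closed[OF L.alpha_linear] linear_map_closed[OF L.beta_linear])

section \<open>Skew-symmetry\<close>

lemma skew_symmetry':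
  assumes x: "\<And>i. i \<in> {1..n} \<Longrightarrow> d i \<in> carrier \<Gamma> \<and> x i \<in> Tg (d i)" and k: "k \<in> {1..n - 1}"
  shows "C x = \<ominus>\<^bsub>T\<^esub> (\<epsilon> (d k) (d (k + 1)) \<odot>\<^bsub>T\<^esub> C (x \<circ> transpose k (k + 1)))"
proof -
  let ?\<tau> = "transpose k (k + 1)"
  have d: "d i \<in> carrier \<Gamma>" if "i \<in> {1..n}" for i using x that by blast
  have kn: "k \<in> {1..n}" "k + 1 \<in> {1..n}" using k by auto
  have \<epsilon>: "\<epsilon> (d k) (d (k + 1)) \<in> carrier K"
    using L.bichar_units[OF d d] kn by (auto simp: Units_def)
  have \<tau>: "?\<tau> i \<in> {1..n}" if "i \<in> {1..n}" for i using kn that by (auto simp: transpose_def)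
  have \<tau>\<tau>: "?\<tau> (?\<tau> i) = i" for i by simp
  show ?thesis
  proof (rule slotwise_induct[where P = "\<lambda>x. C x = \<ominus>\<^bsub>T\<^esub> (\<epsilon> (d k) (d (k + 1)) \<odot>\<^bsub>T\<^esub> C (x \<circ> ?\<tau>))"
        and I = "{1..n}" and x = x and X = "\<lambda>i. Lg (d i)" and K = K and M = A and N = L])
    show "x i \<in> Tg (d i)" if "i \<in> {1..n}" for i using x that by blast
  next
    fix x i s t
    assume i: "i \<in> {1..n}" and x: "\<And>j. j \<in> {1..n} \<Longrightarrow> x j \<in> Tg (d j)"
      and st: "s \<in> Tg (d i)" "t \<in> Tg (d i)"
      and s: "C (x(i := s)) = \<ominus>\<^bsub>T\<^esub> (\<epsilon> (d k) (d (k + 1)) \<odot>\<^bsub>T\<^esub> C (x(i := s) \<circ> ?\<tau>))"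
      and t: "C (x(i := t)) = \<ominus>\<^bsub>T\<^esub> (\<epsilon> (d k) (d (k + 1)) \<odot>\<^bsub>T\<^esub> C (x(i := t) \<circ> ?\<tau>))"
    have xT: "x j \<in> carrier T" if "j \<in> {1..n}" for j
      using tensor_component_closed[OF d x] that by blast
    have stT: "s \<in> carrier T" "t \<in> carrier T" using tensor_component_closed[OF d[OF i]] st by auto
    \<comment> \<open>As the exchange is an involution, updating \<open>x\<close> at
      \<open>i\<close> and then exchanging means updating the exchanged family at the image of
      \<open>i\<close>. So the right-hand side is linear in this argument too, through a possibly
      different slot of \<open>C\<close>.\<close>
    have "?\<tau> j = i \<longleftrightarrow> j = ?\<tau> i" for j using \<tau>\<tau> by metis
    then have upd: "x(i := r) \<circ> ?\<tau> = (x \<circ> ?\<tau>)(?\<tau> i := r)" for r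
      by (simp add: fun_eq_iff)
    have lin1: "linear_map K T T (\<lambda>r. C (x(i := r)))" using xT by (intro C_linear i) auto
    have "linear_map K T T (\<lambda>r. C ((x \<circ> ?\<tau>)(?\<tau> i := r)))"
      using xT \<tau> i by (intro C_linear) auto
    then have lin2: "linear_map K T T (\<lambda>r. \<ominus>\<^bsub>T\<^esub> (\<epsilon> (d k) (d (k + 1)) \<odot>\<^bsub>T\<^esub> C (x(i := r) \<circ> ?\<tau>)))"
      unfolding upd
      using linear_map_compose[OF linear_map_scale[OF T.module_axioms T.module_axioms _ \<epsilon>]
          linear_map_uminus[OF T.module_axioms]] by blast
    show "C (x(i := s \<oplus>\<^bsub>T\<^esub> t)) =
        \<ominus>\<^bsub>T\<^esub> (\<epsilon> (d k) (d (k + 1)) \<odot>\<^bsub>T\<^esub> C (x(i := s \<oplus>\<^bsub>T\<^esub> t) \<circ> ?\<tau>))"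
      unfolding linear_map_add[OF lin1 stT] linear_map_add[OF lin2 stT] s t ..
  next
    fix x :: "nat \<Rightarrow> _"
    assume "\<And>i. i \<in> {1..n} \<Longrightarrow> \<exists>a\<in>carrier A. \<exists>y\<in>Lg (d i). x i = a \<otimes>\<otimes> y"
    then obtain a y where ay: "\<And>i. i \<in> {1..n} \<Longrightarrow> a i \<in> carrier A \<and> y i \<in> Lg (d i) \<and> x i = a i \<otimes>\<otimes> y i"
      by metis
    have yL: "y i \<in> carrier L" if "i \<in> {1..n}" for i using L.component_closed d ay that by blast
    let ?p = "nonempty_prod A (map a [1..<Suc n])"
    have p: "?p \<in> carrier A" using ay by (intro prod_closed) auto
    let ?z = "br (bihom_args n \<alpha> \<beta> (y \<circ> ?\<tau>))"
    have z: "?z \<in> carrier L" using yL \<tau> by (intro bihom_bracket_closed) auto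
    \<comment> \<open>The exchange permutes the first factors, so their multiset and hence their
      product is unchanged.\<close>
    have "bij_betw ?\<tau> {1..n} {1..n}"
      by (rule bij_betw_byWitness[where f' = ?\<tau>]) (use \<tau> in auto)
    then have "image_mset ?\<tau> (mset_set {1..n}) = mset_set {1..n}"
      by (simp add: bij_betw_def image_mset_mset_set)
    then have "mset (map (a \<circ> ?\<tau>) [1..<Suc n]) = mset (map a [1..<Suc n])"
      by (simp add: atLeastLessThanSuc_atLeastAtMost multiset.map_comp[symmetric] del: upt_Suc)
    then have perm: "nonempty_prod A (map (a \<circ> ?\<tau>) [1..<Suc n]) = ?p"
      using ay \<tau> by (intro nonempty_prod_mset_cong) (auto simp del: upt_Suc)
    have C\<tau>: "C (x \<circ> ?\<tau>) = ?p \<otimes>\<otimes> ?z"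
      using C_pure[of "a \<circ> ?\<tau>" "y \<circ> ?\<tau>" "x \<circ> ?\<tau>"] ay yL \<tau> perm by (simp del: upt_Suc)
    have "C x = ?p \<otimes>\<otimes> br (bihom_args n \<alpha> \<beta> y)" using ay yL by (intro C_pure) auto
    also have "br (bihom_args n \<alpha> \<beta> y) = \<ominus>\<^bsub>L\<^esub> (\<epsilon> (d k) (d (k + 1)) \<odot>\<^bsub>L\<^esub> ?z)"
      using L.skew_symmetry[of d y k] d ay k by blast
    also have "?p \<otimes>\<otimes> \<dots> = \<ominus>\<^bsub>T\<^esub> (\<epsilon> (d k) (d (k + 1)) \<odot>\<^bsub>T\<^esub> (?p \<otimes>\<otimes> ?z))"
      using linear_map_minus[OF L.module_axioms T.module_axioms pure_linear_right[OF p]]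
        linear_map_smult[OF pure_linear_right[OF p] \<epsilon> z] z \<epsilon> by simp
    finally show "C x = \<ominus>\<^bsub>T\<^esub> (\<epsilon> (d k) (d (k + 1)) \<odot>\<^bsub>T\<^esub> C (x \<circ> ?\<tau>))" unfolding C\<tau> .
  qed simp
qed

section \<open>The Jacobi identity\<close>

lemma B_fun_upd_linear:
  assumes k: "k \<in> {1..n}" and h: "\<And>i. i \<in> {1..n} - {k} \<Longrightarrow> h i \<in> carrier T"
    and f: "linear_map K T T f"
  shows "linear_map K T T (\<lambda>s. B (h(k := f s)))"
  by (rule linear_map_compose[OF f B_linear[OF k h]])

abbreviation "\<beta>\<beta> x i \<equiv> \<beta>' (\<beta>' (x i))"

text \<open>There are only n - 1 elements \<open>x\<close>; entry \<open>n\<close> of the family is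
  a free place, overwritten by the inner bracket on the left and by \<open>y k\<close> on the right.
  The coefficients \<open>c\<close> stay abstract, since linearity requires only scalars independent
  of the elements.\<close>

abbreviation "jacobi_left x y \<equiv> B ((\<beta>\<beta> x)(n := C y))"

abbreviation "jacobi_term c x y k \<equiv> c k \<odot>\<^bsub>T\<^esub> B ((\<beta>\<beta> y)(k := C (x(n := y k))))"

abbreviation "jacobi_right c x y \<equiv> (\<Oplus>\<^bsub>T\<^esub>k\<in>{1..n}. jacobi_term c x y k)"

lemma beta_beta_linear: "linear_map K T T (\<lambda>s. \<beta>' (\<beta>' s))"
  by (rule linear_map_compose[OF beta'_linear beta'_linear])

lemma beta_beta_closed: "s \<in> carrier T \<Longrightarrow> \<beta>' (\<beta>' s) \<in> carrier T"
  by (rule linear_map_closed[OF beta_beta_linear])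

text \<open>Every argument occurs exactly once on the left and exactly once in each summand on the
  right, in the inner or in the outer bracket. Each side is thus a composition of linear maps in
  that argument, or a sum of such compositions.\<close>

lemma
  assumes x: "\<And>i. i \<in> {1..n - 1} \<Longrightarrow> x i \<in> carrier T"
    and y: "\<And>i. i \<in> {1..n} \<Longrightarrow> y i \<in> carrier T"
    and c: "\<And>k. k \<in> {1..n} \<Longrightarrow> c k \<in> carrier K"
  shows jacobi_left_linear1: "i \<in> {1..n - 1} \<Longrightarrow> linear_map K T T (\<lambda>s. jacobi_left (x(i := s)) y)"
    and jacobi_left_linear2: "i \<in> {1..n} \<Longrightarrow> linear_map K T T (\<lambda>s. jacobi_left x (y(i := s)))"
    and jacobi_right_linear1:
      "i \<in> {1..n - 1} \<Longrightarrow> linear_map K T T (\<lambda>s. jacobi_right c (x(i := s)) y)"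
    and jacobi_right_linear2:
      "i \<in> {1..n} \<Longrightarrow> linear_map K T T (\<lambda>s. jacobi_right c x (y(i := s)))"
proof -
  note T = T.module_axioms
  have n: "n \<in> {1..n}" using L.arity by simp
  have Cy: "C y \<in> carrier T" using y by (intro C_closed)
  have Cx: "C (x(n := t)) \<in> carrier T" if "t \<in> carrier T" for t
    using x that by (intro C_closed) auto
  have \<beta>x: "\<beta>' (\<beta>' (x i)) \<in> carrier T" if "i \<in> {1..n} - {n}" for i
    using that by (intro beta_beta_closed x) auto
  have \<beta>y: "\<beta>' (\<beta>' (y i)) \<in> carrier T" if "i \<in> {1..n}" for i
    using that by (intro beta_beta_closed y) auto
  have y_lin: "linear_map K T T (\<lambda>s. jacobi_left x (y(i := s)))" if i: "i \<in> {1..n}" for i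
    using y by (intro B_fun_upd_linear[OF n] C_linear[OF i] \<beta>x) auto
  show "linear_map K T T (\<lambda>s. jacobi_left x (y(i := s)))" if "i \<in> {1..n}" using y_lin[OF that] .
  show "linear_map K T T (\<lambda>s. jacobi_left (x(i := s)) y)" if i: "i \<in> {1..n - 1}"
  proof -
    have "linear_map K T T (\<lambda>s. B (((\<beta>\<beta> x)(n := C y))(i := \<beta>' (\<beta>' s))))"
      using i \<beta>x Cy by (intro B_fun_upd_linear beta_beta_linear) auto
    \<comment> \<open>Since \<open>i\<close> is at most n - 1, the updates at \<open>i\<close> and
      \<open>n\<close> concern different slots.\<close>
    moreover have "(\<lambda>j. \<beta>\<beta> (x(i := s)) j)(n := C y) = ((\<beta>\<beta> x)(n := C y))(i := \<beta>' (\<beta>' s))" for s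
      using i by (auto simp: fun_eq_iff)
    ultimately show ?thesis by simp
  qed
  show "linear_map K T T (\<lambda>s. jacobi_right c (x(i := s)) y)" if i: "i \<in> {1..n - 1}"
  proof (intro linear_map_finsum_fun T linear_map_scale c)
    fix k assume k: "k \<in> {1..n}"
    have "linear_map K T T (\<lambda>s. B ((\<beta>\<beta> y)(k := C ((x(n := y k))(i := s)))))"
      using i x y k \<beta>y by (intro B_fun_upd_linear[OF k] C_linear) auto
    moreover have "(x(i := s))(n := y k) = (x(n := y k))(i := s)" for s
      using i by (auto simp: fun_eq_iff)
    ultimately show "linear_map K T T (\<lambda>s. B ((\<beta>\<beta> y)(k := C ((x(i := s))(n := y k)))))" by simp
  qed simp
  show "linear_map K T T (\<lambda>s. jacobi_right c x (y(i := s)))" if i: "i \<in> {1..n}"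
  proof (intro linear_map_finsum_fun T linear_map_scale c)
    fix k assume k: "k \<in> {1..n}"
    show "linear_map K T T (\<lambda>s. B ((\<beta>\<beta> (y(i := s)))(k := C (x(n := (y(i := s)) k)))))"
    proof (cases "i = k")
      \<comment> \<open>In the summand of its own index, the argument occurs only as the last entry
        of the inner bracket.\<close>
      case True
      have "linear_map K T T (\<lambda>s. B ((\<beta>\<beta> y)(k := C (x(n := s)))))"
        using \<beta>y x by (intro B_fun_upd_linear[OF k] C_linear[OF n]) auto
      moreover have "(\<lambda>j. \<beta>\<beta> (y(i := s)) j)(k := C (x(n := (y(i := s)) k))) =
          (\<beta>\<beta> y)(k := C (x(n := s)))" for s
        using True by (auto simp: fun_eq_iff)
      ultimately show ?thesis by simp
    next
      \<comment> \<open>In every other summand it occurs only in the outer bracket, under the square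
        of \<open>\<beta>'\<close>, and the inner bracket is constant.\<close>
      case False
      have "linear_map K T T (\<lambda>s. B (((\<beta>\<beta> y)(k := C (x(n := y k))))(i := \<beta>' (\<beta>' s))))"
        using \<beta>y Cx[OF y[OF k]] by (intro B_fun_upd_linear[OF i] beta_beta_linear) auto
      moreover have "(\<lambda>j. \<beta>\<beta> (y(i := s)) j)(k := C (x(n := (y(i := s)) k))) =
          ((\<beta>\<beta> y)(k := C (x(n := y k))))(i := \<beta>' (\<beta>' s))" for s
        using False by (auto simp: fun_eq_iff)
      ultimately show ?thesis by simp
    qed
  qed simp
qed

lemma jacobi_left_eq: "jacobi_left x y = br' (map (\<lambda>i. \<beta>' (\<beta>' (x i))) [1..<n] @ [C y])"
proof -
  have n: "1 \<le> n" using L.arity by simp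
  have "map ((\<beta>\<beta> x)(n := C y)) [1..<Suc n] = map (\<lambda>i. \<beta>' (\<beta>' (x i))) [1..<n] @ [C y]"
    by (subst upt_snoc[OF n]) auto
  then show ?thesis by simp
qed

lemma B_upd_eq:
  assumes "k \<in> {1..n}"
  shows "B (h(k := z)) = br' (map h [1..<k] @ [z] @ map h [Suc k..<Suc n])"
proof -
  have "map (h(k := z)) [1..<Suc n] = map h [1..<k] @ [z] @ map h [Suc k..<Suc n]"
    by (subst upt_split_Suc[OF assms]) (auto simp del: upt_Suc)
  then show ?thesis by simp
qed

text \<open>The common first factor is the product of all \<open>a i\<close> and \<open>b i\<close>,
  called \<open>?p\<close>. Flattening nested products and reordering gives it in each bracket;
  tensoring with \<open>?p\<close> is linear and therefore carries the Jacobi identity of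
  \<open>L\<close> over.\<close>

lemma jacobi_pure:
  assumes x: "\<And>i. i \<in> {1..n - 1} \<Longrightarrow>
      d i \<in> carrier \<Gamma> \<and> a i \<in> carrier A \<and> u i \<in> Lg (d i) \<and> x i = a i \<otimes>\<otimes> u i"
    and y: "\<And>i. i \<in> {1..n} \<Longrightarrow>
      e i \<in> carrier \<Gamma> \<and> b i \<in> carrier A \<and> w i \<in> Lg (e i) \<and> y i = b i \<otimes>\<otimes> w i"
    and c: "\<And>k. k \<in> {1..n} \<Longrightarrow> c k \<in> carrier K"
    and c_def: "c = (\<lambda>k. \<epsilon> (\<Otimes>\<^bsub>\<Gamma>\<^esub>i\<in>{1..n - 1}. d i) (\<Otimes>\<^bsub>\<Gamma>\<^esub>i\<in>{1..<k}. e i))"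
  shows "jacobi_left x y = jacobi_right c x y"
proof -
  note T = T.module_axioms
  have n: "n \<in> {1..n}" "1 \<le> n" using L.arity by auto
  have uL: "u i \<in> carrier L" if "i \<in> {1..n - 1}" for i using x[OF that] L.component_closed by blast
  have wL: "w i \<in> carrier L" if "i \<in> {1..n}" for i using y[OF that] L.component_closed by blast
  note \<beta>_closed = linear_map_closed[OF L.beta_linear]
  let ?p = "nonempty_prod A (map a [1..<n] @ map b [1..<Suc n])"
  let ?z = "\<lambda>k. br (map (\<lambda>i. \<beta> (\<beta> (w i))) [1..<k] @ [br (bihom_args n \<alpha> \<beta> (u(n := w k)))] @
      map (\<lambda>i. \<beta> (\<beta> (w i))) [Suc k..<Suc n])"
  have aA: "set (map a [1..<n]) \<subseteq> carrier A" and bA: "set (map b [1..<Suc n]) \<subseteq> carrier A"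
    using x y by (auto simp del: upt_Suc)
  have p: "?p \<in> carrier A" using aA bA n by (intro nonempty_prod_closed) auto
  have left: "jacobi_left x y = ?p \<otimes>\<otimes>
      br (map (\<lambda>i. \<beta> (\<beta> (u i))) [1..<n] @ [br (bihom_args n \<alpha> \<beta> w)])"
  proof -
    let ?as = "(\<lambda>i. a i)(n := nonempty_prod A (map b [1..<Suc n]))"
    let ?xs = "(\<lambda>i. \<beta> (\<beta> (u i)))(n := br (bihom_args n \<alpha> \<beta> w))"
    have "C y = nonempty_prod A (map b [1..<Suc n]) \<otimes>\<otimes> br (bihom_args n \<alpha> \<beta> w)"
      using y wL by (intro C_pure) auto
    moreover have "nonempty_prod A (map b [1..<Suc n]) \<in> carrier A" using y by (intro prod_closed) auto
    moreover have "br (bihom_args n \<alpha> \<beta> w) \<in> carrier L" by (intro bihom_bracket_closed wL)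
    ultimately have "jacobi_left x y =
        nonempty_prod A (map ?as [1..<Suc n]) \<otimes>\<otimes> br (map ?xs [1..<Suc n])"
      using x uL \<beta>_closed by (intro B_pure) (auto simp: beta'_pure simp del: upt_Suc)
    also have "map ?xs [1..<Suc n] = map (\<lambda>i. \<beta> (\<beta> (u i))) [1..<n] @ [br (bihom_args n \<alpha> \<beta> w)]"
      by (subst upt_snoc[OF n(2)]) auto
    also have "map ?as [1..<Suc n] = map a [1..<n] @ nonempty_prod A (map b [1..<Suc n]) # []"
      by (subst upt_snoc[OF n(2)]) (auto simp del: upt_Suc)
    also have "nonempty_prod A \<dots> = nonempty_prod A (map a [1..<n] @ map b [1..<Suc n] @ [])"
      using aA bA n by (intro nonempty_prod_nested) auto
    finally show ?thesis unfolding append_Nil2 .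
  qed
  have right: "B ((\<beta>\<beta> y)(k := C (x(n := y k)))) = ?p \<otimes>\<otimes> ?z k" and z: "?z k \<in> carrier L"
    if k: "k \<in> {1..n}" for k
  proof -
    let ?a = "a(n := b k)" and ?u = "u(n := w k)"
    let ?q = "nonempty_prod A (map ?a [1..<Suc n])"
    let ?r = "br (bihom_args n \<alpha> \<beta> ?u)"
    let ?as = "b(k := ?q)" and ?xs = "(\<lambda>i. \<beta> (\<beta> (w i)))(k := ?r)"
    have "C (x(n := y k)) = ?q \<otimes>\<otimes> ?r"
      using x uL y[OF k] wL[OF k] by (intro C_pure) auto
    moreover have "?q \<in> carrier A" using x y[OF k] by (intro prod_closed) auto
    moreover have r: "?r \<in> carrier L" using uL wL[OF k] by (intro bihom_bracket_closed) auto
    ultimately have "B ((\<beta>\<beta> y)(k := C (x(n := y k)))) =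
        nonempty_prod A (map ?as [1..<Suc n]) \<otimes>\<otimes> br (map ?xs [1..<Suc n])"
      using y wL \<beta>_closed by (intro B_pure) (auto simp: beta'_pure simp del: upt_Suc)
    also have xs: "map ?xs [1..<Suc n] = map (\<lambda>i. \<beta> (\<beta> (w i))) [1..<k] @ [?r] @
        map (\<lambda>i. \<beta> (\<beta> (w i))) [Suc k..<Suc n]"
      by (subst upt_split_Suc[OF k]) (auto simp del: upt_Suc)
    also have "map ?as [1..<Suc n] = map b [1..<k] @ ?q # map b [Suc k..<Suc n]"
      by (subst upt_split_Suc[OF k]) (auto simp del: upt_Suc)
    also have "nonempty_prod A \<dots> =
        nonempty_prod A (map b [1..<k] @ map ?a [1..<Suc n] @ map b [Suc k..<Suc n])"
      using aA bA n k x y by (intro nonempty_prod_nested) (auto simp del: upt_Suc)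
    also have "\<dots> = ?p"
    proof (rule nonempty_prod_mset_cong)
      \<comment> \<open>The inner bracket contributes \<open>b k\<close> after the entries of
        \<open>a\<close>, exactly the entry missing between the two outer pieces of
        \<open>b\<close>.\<close>
      have "map ?a [1..<Suc n] = map a [1..<n] @ [b k]"
        by (subst upt_snoc[OF n(2)]) auto
      moreover have "map b [1..<Suc n] = map b [1..<k] @ b k # map b [Suc k..<Suc n]"
        by (subst upt_split_Suc[OF k]) (auto simp del: upt_Suc)
      ultimately show "mset (map b [1..<k] @ map ?a [1..<Suc n] @ map b [Suc k..<Suc n]) =
          mset (map a [1..<n] @ map b [1..<Suc n])"
        by (simp del: upt_Suc)
      show "set (map b [1..<k] @ map ?a [1..<Suc n] @ map b [Suc k..<Suc n]) \<subseteq> carrier A"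
        using k x y by (auto simp del: upt_Suc)
    qed
    finally show "B ((\<beta>\<beta> y)(k := C (x(n := y k)))) = ?p \<otimes>\<otimes> ?z k" .
    show "?z k \<in> carrier L"
      unfolding xs[symmetric] using r wL \<beta>_closed by (intro bracket_closed) (auto simp del: upt_Suc)
  qed
  \<comment> \<open>The identity of \<open>L\<close> is applied inside the second factor; linearity
    then moves the sum and its coefficients outside.\<close>
  have "jacobi_left x y = ?p \<otimes>\<otimes> (\<Oplus>\<^bsub>L\<^esub>k\<in>{1..n}. c k \<odot>\<^bsub>L\<^esub> ?z k)"
    unfolding left c_def using x y by (subst L.jacobi[of d u e w]) auto
  also have "\<dots> = (\<Oplus>\<^bsub>T\<^esub>k\<in>{1..n}. ?p \<otimes>\<otimes> (c k \<odot>\<^bsub>L\<^esub> ?z k))"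
    using c z by (intro linear_map_finsum[OF L.module_axioms T pure_linear_right[OF p]]) auto
  also have "\<dots> = jacobi_right c x y"
    using c z right linear_map_smult[OF pure_linear_right[OF p]] pure_closed[OF p]
    by (intro T.M.finsum_cong') auto
  finally show ?thesis .
qed

text \<open>Two nested slotwise inductions: the outer one makes the \<open>x\<close> pure while the
  \<open>y\<close> are arbitrary homogeneous elements, the inner one then treats the
  \<open>y\<close> with pure \<open>x\<close>.\<close>

lemma jacobi':
  assumes x: "\<And>i. i \<in> {1..n - 1} \<Longrightarrow> d i \<in> carrier \<Gamma> \<and> x i \<in> Tg (d i)"
    and y: "\<And>i. i \<in> {1..n} \<Longrightarrow> e i \<in> carrier \<Gamma> \<and> y i \<in> Tg (e i)"
    and c_def: "c = (\<lambda>k. \<epsilon> (\<Otimes>\<^bsub>\<Gamma>\<^esub>i\<in>{1..n - 1}. d i) (\<Otimes>\<^bsub>\<Gamma>\<^esub>i\<in>{1..<k}. e i))"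
  shows "jacobi_left x y = jacobi_right c x y"
proof -
  have d: "d i \<in> carrier \<Gamma>" if "i \<in> {1..n - 1}" for i using x that by blast
  have e: "e i \<in> carrier \<Gamma>" if "i \<in> {1..n}" for i using y that by blast
  have c: "c k \<in> carrier K" if "k \<in> {1..n}" for k
  proof -
    have "(\<Otimes>\<^bsub>\<Gamma>\<^esub>i\<in>{1..n - 1}. d i) \<in> carrier \<Gamma>" "(\<Otimes>\<^bsub>\<Gamma>\<^esub>i\<in>{1..<k}. e i) \<in> carrier \<Gamma>"
      using d e that by (auto intro!: L.\<Gamma>.finprod_closed)
    from L.bichar_units[OF this] show ?thesis by (simp add: c_def Units_def)
  qed
  show ?thesis
  proof (rule slotwise_induct[where P = "\<lambda>x. jacobi_left x y = jacobi_right c x y"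
        and I = "{1..n - 1}" and x = x and X = "\<lambda>i. Lg (d i)" and K = K and M = A and N = L])
    show "x i \<in> Tg (d i)" if "i \<in> {1..n - 1}" for i using x that by blast
  next
    fix x i s t
    assume i: "i \<in> {1..n - 1}" and x: "\<And>j. j \<in> {1..n - 1} \<Longrightarrow> x j \<in> Tg (d j)"
      and st: "s \<in> Tg (d i)" "t \<in> Tg (d i)"
      and eq: "jacobi_left (x(i := s)) y = jacobi_right c (x(i := s)) y"
        "jacobi_left (x(i := t)) y = jacobi_right c (x(i := t)) y"
    have xT: "x j \<in> carrier T" if "j \<in> {1..n - 1}" for j
      using tensor_component_closed[OF d x] that by blast
    have yT: "y j \<in> carrier T" if "j \<in> {1..n}" for j
      using tensor_component_closed y that by blast
    have stT: "s \<in> carrier T" "t \<in> carrier T" using tensor_component_closed[OF d[OF i]] st by auto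
    have lin: "linear_map K T T (\<lambda>s. jacobi_left (x(i := s)) y)"
      "linear_map K T T (\<lambda>s. jacobi_right c (x(i := s)) y)"
      by (rule jacobi_left_linear1[OF xT yT c i] jacobi_right_linear1[OF xT yT c i]; assumption)+
    show "jacobi_left (x(i := s \<oplus>\<^bsub>T\<^esub> t)) y = jacobi_right c (x(i := s \<oplus>\<^bsub>T\<^esub> t)) y"
      by (simp only: linear_map_add[OF lin(1) stT] linear_map_add[OF lin(2) stT] eq)
  next
    fix x :: "nat \<Rightarrow> _"
    assume "\<And>i. i \<in> {1..n - 1} \<Longrightarrow> \<exists>a\<in>carrier A. \<exists>u\<in>Lg (d i). x i = a \<otimes>\<otimes> u"
    then obtain a u where au:
      "\<And>i. i \<in> {1..n - 1} \<Longrightarrow> a i \<in> carrier A \<and> u i \<in> Lg (d i) \<and> x i = a i \<otimes>\<otimes> u i" by metis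
    have xT: "x i \<in> carrier T" if "i \<in> {1..n - 1}" for i
      using au[OF that] pure_closed L.component_closed[OF d[OF that]] by simp
    show "jacobi_left x y = jacobi_right c x y"
    proof (rule slotwise_induct[where P = "\<lambda>y. jacobi_left x y = jacobi_right c x y"
        and I = "{1..n}" and x = y and X = "\<lambda>i. Lg (e i)" and K = K and M = A and N = L])
      show "y i \<in> Tg (e i)" if "i \<in> {1..n}" for i using y that by blast
    next
      fix y i s t
      assume i: "i \<in> {1..n}" and y: "\<And>j. j \<in> {1..n} \<Longrightarrow> y j \<in> Tg (e j)"
        and st: "s \<in> Tg (e i)" "t \<in> Tg (e i)"
        and eq: "jacobi_left x (y(i := s)) = jacobi_right c x (y(i := s))"
          "jacobi_left x (y(i := t)) = jacobi_right c x (y(i := t))"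
      have yT: "y j \<in> carrier T" if "j \<in> {1..n}" for j
        using tensor_component_closed[OF e y] that by blast
      have stT: "s \<in> carrier T" "t \<in> carrier T" using tensor_component_closed[OF e[OF i]] st by auto
      have lin: "linear_map K T T (\<lambda>s. jacobi_left x (y(i := s)))"
        "linear_map K T T (\<lambda>s. jacobi_right c x (y(i := s)))"
        by (rule jacobi_left_linear2[OF xT yT c i] jacobi_right_linear2[OF xT yT c i]; assumption)+
      show "jacobi_left x (y(i := s \<oplus>\<^bsub>T\<^esub> t)) = jacobi_right c x (y(i := s \<oplus>\<^bsub>T\<^esub> t))"
        by (simp only: linear_map_add[OF lin(1) stT] linear_map_add[OF lin(2) stT] eq)
    next
      fix y :: "nat \<Rightarrow> _"
      assume "\<And>i. i \<in> {1..n} \<Longrightarrow> \<exists>b\<in>carrier A. \<exists>w\<in>Lg (e i). y i = b \<otimes>\<otimes> w"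
      then obtain b w where bw:
        "\<And>i. i \<in> {1..n} \<Longrightarrow> b i \<in> carrier A \<and> w i \<in> Lg (e i) \<and> y i = b i \<otimes>\<otimes> w i" by metis
      show "jacobi_left x y = jacobi_right c x y"
        using d e au bw by (intro jacobi_pure[where a = a and b = b and u = u and w = w, OF _ _ c c_def]) auto
    qed simp
  qed simp
qed

section \<open>Compatibility with degrees\<close>

lemma bracket_even':
  assumes x: "\<And>i. i \<in> {1..n} \<Longrightarrow> d i \<in> carrier \<Gamma> \<and> x i \<in> Tg (d i)"
  shows "B x \<in> Tg (\<Otimes>\<^bsub>\<Gamma>\<^esub>i\<in>{1..n}. d i)"
proof -
  have d: "d i \<in> carrier \<Gamma>" if "i \<in> {1..n}" for i using x that by blast
  show ?thesis
  proof (rule slotwise_induct[where P = "\<lambda>x. B x \<in> Tg (\<Otimes>\<^bsub>\<Gamma>\<^esub>i\<in>{1..n}. d i)"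
        and I = "{1..n}" and x = x and X = "\<lambda>i. Lg (d i)" and K = K and M = A and N = L])
    show "x i \<in> Tg (d i)" if "i \<in> {1..n}" for i using x that by blast
  next
    fix x i s t
    assume i: "i \<in> {1..n}" and x: "\<And>j. j \<in> {1..n} \<Longrightarrow> x j \<in> Tg (d j)"
      and st: "s \<in> Tg (d i)" "t \<in> Tg (d i)"
      and B: "B (x(i := s)) \<in> Tg (\<Otimes>\<^bsub>\<Gamma>\<^esub>i\<in>{1..n}. d i)" "B (x(i := t)) \<in> Tg (\<Otimes>\<^bsub>\<Gamma>\<^esub>i\<in>{1..n}. d i)"
    have stT: "s \<in> carrier T" "t \<in> carrier T" using tensor_component_closed[OF d[OF i]] st by auto
    \<comment> \<open>The target component is determined by the degrees \<open>d\<close> alone, so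
      it is the same for \<open>s\<close> and \<open>t\<close>, and it is closed under
      addition.\<close>
    have "linear_map K T T (\<lambda>r. B (x(i := r)))"
      using tensor_component_closed[OF d x] by (intro B_linear[OF i]) auto
    from linear_map_add[OF this stT] tensor_sums.add[OF B]
    show "B (x(i := s \<oplus>\<^bsub>T\<^esub> t)) \<in> Tg (\<Otimes>\<^bsub>\<Gamma>\<^esub>i\<in>{1..n}. d i)" by simp
  next
    fix x :: "nat \<Rightarrow> _"
    assume "\<And>i. i \<in> {1..n} \<Longrightarrow> \<exists>a\<in>carrier A. \<exists>y\<in>Lg (d i). x i = a \<otimes>\<otimes> y"
    then obtain a y where ay: "\<And>i. i \<in> {1..n} \<Longrightarrow> a i \<in> carrier A \<and> y i \<in> Lg (d i) \<and> x i = a i \<otimes>\<otimes> y i"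
      by metis
    have "B x = nonempty_prod A (map a [1..<Suc n]) \<otimes>\<otimes> br (map y [1..<Suc n])"
      using ay L.component_closed[OF d] by (intro B_pure) auto
    moreover have "nonempty_prod A (map a [1..<Suc n]) \<in> carrier A" using ay by (intro prod_closed) auto
    moreover have "br (map y [1..<Suc n]) \<in> Lg (\<Otimes>\<^bsub>\<Gamma>\<^esub>i\<in>{1..n}. d i)"
      using d ay by (intro L.bracket_even) auto
    ultimately show "B x \<in> Tg (\<Otimes>\<^bsub>\<Gamma>\<^esub>i\<in>{1..n}. d i)" by (simp add: tensor_sums.pure del: upt_Suc)
  qed simp
qed

text \<open>Such a map acts on second factors only. The general form serves \<open>\<alpha>'\<close>
  and \<open>\<beta>'\<close> alike.\<close>

lemma even_map:
  assumes lin: "linear_map K T T f" and pure: "\<And>a x. \<lbrakk>a \<in> carrier A; x \<in> carrier L\<rbrakk> \<Longrightarrow> f (a \<otimes>\<otimes> x) = a \<otimes>\<otimes> g x"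
    and even: "\<And>x. x \<in> Lg \<gamma> \<Longrightarrow> g x \<in> Lg \<gamma>" and \<gamma>: "\<gamma> \<in> carrier \<Gamma>" and t: "t \<in> Tg \<gamma>"
  shows "f t \<in> Tg \<gamma>"
  using t
proof induction
  case (pure a x)
  then show ?case
    using assms(2)[of a x] L.component_closed[OF \<gamma>] even by (simp add: tensor_sums.pure)
next
  case (add s t)
  then show ?case
    using linear_map_add[OF lin, of s t] tensor_component_closed[OF \<gamma>] by (simp add: tensor_sums.add)
qed

section \<open>Assembly of the algebra structure\<close>

lemma n_BiHom_Lie_color_algebra_tensor:
  "n_BiHom_Lie_color_algebra K \<Gamma> n T (tensor_grading K A L Lg) br' \<epsilon> \<alpha>' \<beta>'"
proof (intro n_BiHom_Lie_color_algebra.intro n_BiHom_Lie_color_algebra_axioms.intro)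
  show "graded_vector_space K \<Gamma> T (tensor_grading K A L Lg)" by (rule graded_vector_space_tensor)
  show "bicharacter K \<Gamma> \<epsilon>" by (rule L.bicharacter_axioms)
  show "2 \<le> n" by (rule L.arity)
  show "multilinear_map K T n br'" by (rule br'_multilinear)
  show "linear_map K T T \<alpha>'" by (rule alpha'_linear)
  show "linear_map K T T \<beta>'" by (rule beta'_linear)
  show "\<alpha>' t \<in> tensor_grading K A L Lg \<gamma>"
    if "\<gamma> \<in> carrier \<Gamma>" "t \<in> tensor_grading K A L Lg \<gamma>" for \<gamma> t
    using even_map[OF alpha'_linear alpha'_pure L.alpha_even] that by (simp add: tensor_grading_eq)
  show "\<beta>' t \<in> tensor_grading K A L Lg \<gamma>"
    if "\<gamma> \<in> carrier \<Gamma>" "t \<in> tensor_grading K A L Lg \<gamma>" for \<gamma> t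
    using even_map[OF beta'_linear beta'_pure L.beta_even] that by (simp add: tensor_grading_eq)
  show "\<alpha>' (\<beta>' t) = \<beta>' (\<alpha>' t)" if "t \<in> carrier T" for t
    \<comment> \<open>Both composites are linear, so commutation is needed on pure tensors only,
      where it is that of \<alpha> and \<beta>.\<close>
    by (rule linear_map_eqI[OF linear_map_compose[OF beta'_linear alpha'_linear]
          linear_map_compose[OF alpha'_linear beta'_linear] _ that])
      (simp add: alpha'_pure beta'_pure linear_map_closed[OF L.alpha_linear]
        linear_map_closed[OF L.beta_linear] L.alpha_beta)
next
  fix d x
  assume x: "\<And>i. i \<in> {1..n} \<Longrightarrow> d i \<in> carrier \<Gamma> \<and> x i \<in> tensor_grading K A L Lg (d i)"
  then have "d i \<in> carrier \<Gamma>" if "i \<in> {1..n}" for i using that by blast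
  then have prod: "(\<Otimes>\<^bsub>\<Gamma>\<^esub>i\<in>{1..n}. d i) \<in> carrier \<Gamma>" by (intro L.\<Gamma>.finprod_closed) auto
  have x': "d i \<in> carrier \<Gamma> \<and> x i \<in> Tg (d i)" if "i \<in> {1..n}" for i
    using x[OF that] tensor_grading_eq[of "d i"] by auto
  show "br' (map x [1..<Suc n]) \<in> tensor_grading K A L Lg (\<Otimes>\<^bsub>\<Gamma>\<^esub>i\<in>{1..n}. d i)"
    unfolding tensor_grading_eq[OF prod] by (rule bracket_even'[OF x'])
  show "C x = \<ominus>\<^bsub>T\<^esub> (\<epsilon> (d k) (d (k + 1)) \<odot>\<^bsub>T\<^esub> C (x \<circ> transpose k (k + 1)))" if "k \<in> {1..n - 1}" for k
    by (rule skew_symmetry'[OF x' that])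
next
  fix d x e y
  assume x: "\<And>i. i \<in> {1..n - 1} \<Longrightarrow> d i \<in> carrier \<Gamma> \<and> x i \<in> tensor_grading K A L Lg (d i)"
    and y: "\<And>i. i \<in> {1..n} \<Longrightarrow> e i \<in> carrier \<Gamma> \<and> y i \<in> tensor_grading K A L Lg (e i)"
  let ?c = "\<lambda>k. \<epsilon> (\<Otimes>\<^bsub>\<Gamma>\<^esub>i\<in>{1..n - 1}. d i) (\<Otimes>\<^bsub>\<Gamma>\<^esub>i\<in>{1..<k}. e i)"
  have x': "d i \<in> carrier \<Gamma> \<and> x i \<in> Tg (d i)" if "i \<in> {1..n - 1}" for i
    using x[OF that] tensor_grading_eq[of "d i"] by auto
  have y': "e i \<in> carrier \<Gamma> \<and> y i \<in> Tg (e i)" if "i \<in> {1..n}" for i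
    using y[OF that] tensor_grading_eq[of "e i"] by auto
  have xT: "x i \<in> carrier T" if "i \<in> {1..n - 1}" for i
    using x'[OF that] tensor_component_closed by blast
  have yT: "y i \<in> carrier T" if "i \<in> {1..n}" for i
    using y'[OF that] tensor_component_closed by blast
  \<comment> \<open>This passes from the function updates, convenient for linearity, to the
    concatenated lists in which the axiom is stated.\<close>
  have term_eq: "B ((\<beta>\<beta> y)(k := C (x(n := y k)))) =
      br' (map (\<lambda>i. \<beta>' (\<beta>' (y i))) [1..<k] @ [C (x(n := y k))] @
        map (\<lambda>i. \<beta>' (\<beta>' (y i))) [Suc k..<Suc n])" if "k \<in> {1..n}" for k
    by (rule B_upd_eq[OF that])
  have "br' (map (\<lambda>i. \<beta>' (\<beta>' (x i))) [1..<n] @ [C y]) = jacobi_right ?c x y"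
    unfolding jacobi_left_eq[symmetric] by (rule jacobi'[OF x' y' refl])
  also have "\<dots> = (\<Oplus>\<^bsub>T\<^esub>k\<in>{1..n}. ?c k \<odot>\<^bsub>T\<^esub>
      br' (map (\<lambda>i. \<beta>' (\<beta>' (y i))) [1..<k] @ [C (x(n := y k))] @
        map (\<lambda>i. \<beta>' (\<beta>' (y i))) [Suc k..<Suc n]))"
  proof (rule T.M.finsum_cong')
    show "(\<lambda>k. ?c k \<odot>\<^bsub>T\<^esub> br' (map (\<lambda>i. \<beta>' (\<beta>' (y i))) [1..<k] @ [C (x(n := y k))] @
        map (\<lambda>i. \<beta>' (\<beta>' (y i))) [Suc k..<Suc n])) \<in> {1..n} \<rightarrow> carrier T"
    proof
      fix k assume k: "k \<in> {1..n}"
      have "(\<Otimes>\<^bsub>\<Gamma>\<^esub>i\<in>{1..n - 1}. d i) \<in> carrier \<Gamma>" "(\<Otimes>\<^bsub>\<Gamma>\<^esub>i\<in>{1..<k}. e i) \<in> carrier \<Gamma>"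
        using x y k by (auto intro!: L.\<Gamma>.finprod_closed)
      from L.bichar_units[OF this] have "?c k \<in> carrier K" by (simp add: Units_def)
      moreover have "B ((\<beta>\<beta> y)(k := C (x(n := y k)))) \<in> carrier T"
        using xT yT k by (intro B_closed) (auto intro!: C_closed beta_beta_closed)
      ultimately show "?c k \<odot>\<^bsub>T\<^esub> br' (map (\<lambda>i. \<beta>' (\<beta>' (y i))) [1..<k] @ [C (x(n := y k))] @
        map (\<lambda>i. \<beta>' (\<beta>' (y i))) [Suc k..<Suc n]) \<in> carrier T"
        unfolding term_eq[OF k] by (rule T.smult_closed)
    qed
  qed (simp_all only: term_eq)
  finally show "br' (map (\<lambda>i. \<beta>' (\<beta>' (x i))) [1..<n] @ [C y]) = (\<Oplus>\<^bsub>T\<^esub>k\<in>{1..n}. ?c k \<odot>\<^bsub>T\<^esub>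
      br' (map (\<lambda>i. \<beta>' (\<beta>' (y i))) [1..<k] @ [C (x(n := y k))] @
        map (\<lambda>i. \<beta>' (\<beta>' (y i))) [Suc k..<Suc n]))" .
qed

end

text \<open>The first conjunct keeps the second from being vacuous. The second quantifies over all
  admissible operations, because these are determined only on arguments from the carrier and the
  functions may differ elsewhere.\<close>

theorem theorem3p7:
  fixes K :: "('k, 'm) ring_scheme" and \<Gamma> :: "('g, 'l) monoid_scheme" and n :: nat
    and A :: "('k, 'a, 'p) module_scheme"
    and L :: "('k, 'v, 'q) module_scheme" and Lg :: "'g \<Rightarrow> 'v set"
    and br :: "'v list \<Rightarrow> 'v" and \<epsilon> :: "'g \<Rightarrow> 'g \<Rightarrow> 'k" and \<alpha> \<beta> :: "'v \<Rightarrow> 'v"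
  assumes "field K" and "\<one>\<^bsub>K\<^esub> \<oplus>\<^bsub>K\<^esub> \<one>\<^bsub>K\<^esub> \<noteq> \<zero>\<^bsub>K\<^esub>"
    and "comm_group \<Gamma>"
    and "comm_assoc_algebra K A"
    and "n_BiHom_Lie_color_algebra K \<Gamma> n L Lg br \<epsilon> \<alpha> \<beta>"
  shows "(\<exists>br' \<alpha>' \<beta>'. tensor_operations K A n L br \<alpha> \<beta> br' \<alpha>' \<beta>') \<and>
    (\<forall>br' \<alpha>' \<beta>'. tensor_operations K A n L br \<alpha> \<beta> br' \<alpha>' \<beta>' \<longrightarrow>
      n_BiHom_Lie_color_algebra K \<Gamma> n (tensor_module K A L) (tensor_grading K A L Lg)
        br' \<epsilon> \<alpha>' \<beta>')"
proof -
  have "tensor_color_algebra K \<Gamma> n A L Lg br \<epsilon> \<alpha> \<beta>"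
    using assms(4,5) by (rule tensor_color_algebra.intro)
  then show ?thesis
    using tensor_color_algebra.tensor_operations_exist
      tensor_color_operations.n_BiHom_Lie_color_algebra_tensor
      tensor_color_operations.intro tensor_color_operations_axioms.intro by metis
qed

end
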